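(* Let $d=4$. For every $\alpha>0$ there exist $\epsilon(\alpha)>0$ and $c(\alpha)>0$ such that for all integers $n\ge 1$, $$\mathbb{P}[0\overset{\mathcal{L}_{\alpha}}{\longleftrightarrow}\partial B(0,n)]\ge c(\alpha)\,n^{-2}(\log n)^{\epsilon(\alpha)}.$$
   Context: Let $Q=(Q^x_y)_{x,y}$ be the transition matrix of simple random walk on $\mathbb{Z}^d$. A based loop is an element $\dot\ell=(x_1,\dots,x_n)\in(\mathbb{Z}^d)^n$, $n\ge 2$, with $x_1\ne x_2,\dots,x_{n-1}\neq x_n,x_n\ne x_1$; loops are equivalence classes of based loops under circular permutation. Put $\dot\mu(\dot\ell)=\frac1n Q^{x_1}_{x_2}\cdots Q^{x_{n-1}}_{x_n}Q^{x_n}_{x_1}$ and let $\mu$ be the push-forward of $\dot\mu$ to the space of loops. For $\alpha>0$, $\mathcal{L}_\alpha$ is the Poisson point process of loops with intensity $\alpha\mu$. An edge of $\mathbb{Z}^d$ is open if it is traversed by at least one loop of $\mathcal{L}_\alpha$ (a loop $(x_1,\dots,x_n)$ traverses $\{x_i,x_{i+1}\}$ and $\{x_n,x_1\}$). $0\overset{\mathcal{L}_\alpha}{\longleftrightarrow}A$ means that $0$ is connected to some vertex of $A$ by a path of open edges. $B(x,n)=\{y:\|y-x\|_\infty\le n\}$, and $\partial F=\{x\in F:\ x\text{ has a neighbour outside }F\}$. *)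

theory Defs
  imports "HOL-Probability.Probability"
begin

definition zadj :: "int ^ 'd::finite \<Rightarrow> int ^ 'd \<Rightarrow> bool" where
  "zadj x y \<longleftrightarrow> (\<Sum>i\<in>UNIV. \<bar>x $ i - y $ i\<bar>) = 1"

definition srw_kernel :: "int ^ 'd::finite \<Rightarrow> int ^ 'd \<Rightarrow> real" where
  "srw_kernel x y = (if zadj x y then 1 / (2 * real CARD('d)) else 0)"

definition linf_norm :: "int ^ 'd::finite \<Rightarrow> int" where
  "linf_norm x = (MAX i. \<bar>x $ i\<bar>)"

definition zball :: "int ^ 'd::finite \<Rightarrow> nat \<Rightarrow> (int ^ 'd) set" where
  "zball x n = {y. linf_norm (y - x) \<le> int n}"

definition inner_boundary :: "(int ^ 'd::finite) set \<Rightarrow> (int ^ 'd) set" where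
  "inner_boundary F = {x \<in> F. \<exists>y. zadj x y \<and> y \<notin> F}"


(* Consecutive vertices of a based loop are only required to be distinct;
   based loops with a step that is not nearest-neighbour simply carry no mass. *)

definition based_loops :: "(int ^ 'd::finite) list set" where
  "based_loops = {xs. 2 \<le> length xs \<and> (\<forall>i<length xs. xs ! i \<noteq> xs ! (Suc i mod length xs))}"

definition based_loop_weight :: "(int ^ 'd::finite) list \<Rightarrow> real" where
  "based_loop_weight xs =
     1 / real (length xs) * (\<Prod>i<length xs. srw_kernel (xs ! i) (xs ! (Suc i mod length xs)))"

definition based_loop_measure :: "(int ^ 'd::finite) list measure" where
  "based_loop_measure = point_measure based_loops (\<lambda>xs. ennreal (based_loop_weight xs))"

definition circular_perm :: "((int ^ 'd::finite) list \<times> (int ^ 'd) list) set" where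
  "circular_perm = {(xs, ys). xs \<in> based_loops \<and> (\<exists>k. ys = rotate k xs)}"

definition loops :: "(int ^ 'd::finite) list set set" where
  "loops = based_loops // circular_perm"

definition loop_measure :: "(int ^ 'd::finite) list set measure" where
  "loop_measure = distr based_loop_measure (count_space loops) (\<lambda>xs. circular_perm `` {xs})"

definition traverses :: "(int ^ 'd::finite) list set \<Rightarrow> (int ^ 'd) set \<Rightarrow> bool" where
  "traverses l e \<longleftrightarrow> (\<exists>xs\<in>l. \<exists>i<length xs. e = {xs ! i, xs ! (Suc i mod length xs)})"


(* A Poisson point process with intensity \<nu> is a random counting measure N on the measurable
   space of \<nu>.  A Poisson variable of parameter \<infinity> is \<infinity> almost surely.
   Independence for sequences of disjoint sets includes finite families (pad with {}). *)

definition poisson_point_process :: "'w measure \<Rightarrow> 'a measure \<Rightarrow> ('w \<Rightarrow> 'a measure) \<Rightarrow> bool" where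
  "poisson_point_process M \<nu> N \<longleftrightarrow>
     prob_space M \<and>
     (\<forall>\<omega>\<in>space M. sets (N \<omega>) = sets \<nu> \<and>
        (\<forall>A\<in>sets \<nu>. emeasure (N \<omega>) A \<in> insert \<infinity> (range of_nat))) \<and>
     (\<forall>A\<in>sets \<nu>. (\<lambda>\<omega>. emeasure (N \<omega>) A) \<in> borel_measurable M) \<and>
     (\<forall>A\<in>sets \<nu>. emeasure \<nu> A < \<infinity> \<longrightarrow>
        (\<forall>k::nat. measure M {\<omega> \<in> space M. emeasure (N \<omega>) A = of_nat k}
           = exp (- measure \<nu> A) * measure \<nu> A ^ k / fact k)) \<and>
     (\<forall>A\<in>sets \<nu>. emeasure \<nu> A = \<infinity> \<longrightarrow> (AE \<omega> in M. emeasure (N \<omega>) A = \<infinity>)) \<and>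
     (\<forall>A :: nat \<Rightarrow> 'a set. range A \<subseteq> sets \<nu> \<longrightarrow> disjoint_family A \<longrightarrow>
        prob_space.indep_vars M (\<lambda>_. borel) (\<lambda>i \<omega>. emeasure (N \<omega>) (A i)) UNIV)"

definition loop_soup ::
  "real \<Rightarrow> 'w measure \<Rightarrow> ('w \<Rightarrow> (int ^ 'd::finite) list set measure) \<Rightarrow> bool" where
  "loop_soup \<alpha> M N \<longleftrightarrow> poisson_point_process M (scale_measure (ennreal \<alpha>) loop_measure) N"


(* In the following, L is a realisation of the loop soup, as a counting measure on loops. *)

definition open_edge :: "(int ^ 'd::finite) list set measure \<Rightarrow> int ^ 'd \<Rightarrow> int ^ 'd \<Rightarrow> bool" where
  "open_edge L x y \<longleftrightarrow> zadj x y \<and> (\<exists>l\<in>loops. emeasure L {l} \<noteq> 0 \<and> traverses l {x, y})"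

definition connected_to ::
  "(int ^ 'd::finite) list set measure \<Rightarrow> int ^ 'd \<Rightarrow> (int ^ 'd) set \<Rightarrow> bool" where
  "connected_to L x A \<longleftrightarrow> (\<exists>y\<in>A. (open_edge L)\<^sup>*\<^sup>* x y)"

end

theory Submission
  imports Defs
begin

text \<open>The idea is to let chains of loops at increasing scales transport capacity. Scale $k$ consists of the loops whose
  length is between $2 \cdot 4^k$ and $4 \cdot 4^k$. In dimension four heat kernel bounds alone show that such a loop has
  energy at most of order $k / 4^k$ with respect to its occupation measure, the average of the Green function over
  its pairs of points, and a second moment computation shows that a set carrying a probability measure of energy
  $E$ is hit by such a loop with probability at least of order $1 / (4^k E)$; the same holds for loops restricted to
  have low energy, or to be wide. Hence a set with $1 / E = Y \leq 4^k / k$ (up to constants) is connected by scale $k$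
  to a loop for which $1 / E$ is of order $4^k / k$ with probability of order $Y / 4^k$, which raises the expected
  value of $Y$ by the factor $1 + \varepsilon / k$. The scales are independent, so over the $\log n$ scales up to $n$
  this gains $(\log n)^\varepsilon$, and a final wide loop at scale $4^k \approx n^2$ reaches distance $n$
  with probability of order $Y / n^2$.\<close>

subsection \<open>The heat kernel on the four-dimensional lattice\<close>

text \<open>The heat kernel enters only through an upper bound of order n^-2 at all points and a
  matching lower bound for returns at even times. Both come from exact binomial identities instead
  of a local limit theorem. Closed walks are then controlled by observing that one of the two arcs
  between a pair of times takes at least half of the steps. Dimension four is critical: the mean of
  the Green function after m steps is of order at most 1 / m, and its sum over the length of a loop
  is the logarithm behind the factor k in the energy. This factor is also why one scale gains only 1
  + eps / k, hence a power of log n in total. A set may meet several loops of one scale, and their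
  continuations are dependent, so their probabilities cannot simply be added. Following the first
  loop met in some enumeration cures this: the choice depends on one scale and the continuation on
  larger scales only. For this reason arms are built downwards from the top scale.\<close>

fun bwalk :: "nat \<Rightarrow> int \<Rightarrow> real" where
  "bwalk 0 y = of_bool (y = 0)"
| "bwalk (Suc n) y = (bwalk n (y - 1) + bwalk n (y + 1)) / 2"

lemma bwalk_closed:
  "bwalk n y = (if even (int n + y) \<and> \<bar>y\<bar> \<le> int n then real (n choose nat ((int n + y) div 2)) / 2 ^ n else 0)"
proof (induction n arbitrary: y)
  case (Suc n)
  show ?case
  proof (cases "even (int (Suc n) + y) \<and> \<bar>y\<bar> \<le> int (Suc n)")
    case True
    then obtain k where k: "int (Suc n) + y = 2 * k" by blast
    define i where "i = nat k"
    have i: "k = int i" "i \<le> Suc n" using True k unfolding i_def by auto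
    have y: "y = 2 * int i - int (Suc n)" using k i by simp
    have 1: "bwalk n (y - 1) = (if i = 0 then 0 else real (n choose (i - 1)) / 2 ^ n)"
    proof (cases "i = 0")
      case False
      then obtain i' where i': "i = Suc i'" by (cases i) auto
      show ?thesis unfolding Suc.IH y using i(2) by (simp add: i')
    next
      case True
      then show ?thesis unfolding Suc.IH y by simp
    qed
    have 2: "bwalk n (y + 1) = real (n choose i) / 2 ^ n"
    proof (cases "i = Suc n")
      case True
      then show ?thesis unfolding Suc.IH y by simp
    next
      case False
      then have "i \<le> n" using i by simp
      moreover have "nat ((int n + (2 * int i - int (Suc n) + 1)) div 2) = i" by simp
      ultimately show ?thesis unfolding Suc.IH y by (auto simp: abs_if)
    qed
    have 3: "real (Suc n choose i) = (if i = 0 then 0 else real (n choose (i - 1))) + real (n choose i)"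
      by (cases i) auto
    have 4: "nat ((int (Suc n) + y) div 2) = i" unfolding y by simp
    show ?thesis using True by (simp only: bwalk.simps 1 2 4 3) (auto simp: field_simps)
  next
    case False
    have "bwalk n (y - 1) = 0" unfolding Suc.IH using False by auto
    moreover have "bwalk n (y + 1) = 0" unfolding Suc.IH using False by auto
    ultimately have "bwalk (Suc n) y = 0" by simp
    then show ?thesis using False by (simp only: if_False)
  qed
qed auto

lemma bwalk_nonneg: "bwalk n y \<ge> 0"
  by (simp add: bwalk_closed)

text \<open>Squares keep the Wallis estimate rational, and a planar return probability is exactly
  such a square. Consecutive squares have ratio ((2m + 1) / (2m + 2))^2, which carries both bounds
  through an induction.\<close>

lemma central_binomial_sq_bounds:
  "(real ((2 * m) choose m) / 4 ^ m)\<^sup>2 \<le> 1 / (2 * real m + 1)"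
  "(real ((2 * m) choose m) / 4 ^ m)\<^sup>2 \<ge> 1 / (4 * real m + 1)"
proof -
  define a where "a m = (real ((2 * m) choose m) / 4 ^ m)\<^sup>2" for m :: nat
  have rec: "a (Suc m) = a m * ((2 * real m + 1) / (2 * real m + 2))\<^sup>2" for m
  proof -
    have "Suc m * ((2 * Suc m) choose Suc m) = 2 * (2 * m + 1) * ((2 * m) choose m)"
    proof -
      have e: "2 * Suc m = Suc (Suc (2 * m))" by simp
      have s: "Suc (2 * m) choose m = Suc (2 * m) choose Suc m"
        by (subst binomial_symmetric) auto
      have "(2 * Suc m) choose Suc m = 2 * (Suc (2 * m) choose Suc m)"
        unfolding e using s by simp
      moreover have "Suc m * (Suc (2 * m) choose Suc m) = Suc (2 * m) * ((2 * m) choose m)"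
        by (rule Suc_times_binomial)
      ultimately show ?thesis
        by (simp only: mult.left_commute[of "Suc m" 2] mult.assoc Suc_eq_plus1)
    qed
    from arg_cong[OF this, of real]
    have "(real m + 1) * real ((2 * Suc m) choose Suc m) = 2 * (2 * real m + 1) * real ((2 * m) choose m)"
      unfolding of_nat_mult of_nat_add by (simp only: of_nat_Suc of_nat_numeral of_nat_1 add.commute)
    then have "real ((2 * Suc m) choose Suc m) = 2 * (2 * real m + 1) * real ((2 * m) choose m) / (real m + 1)"
      by (simp add: field_simps)
    then have "real ((2 * Suc m) choose Suc m) / 4 ^ Suc m =
        real ((2 * m) choose m) / 4 ^ m * ((2 * real m + 1) / (2 * real m + 2))"
      by (simp add: divide_simps del: mult_Suc_right binomial_Suc_Suc) algebra
    then show ?thesis unfolding a_def by (simp only: power_mult_distrib)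
  qed
  have "a m \<le> 1 / (2 * real m + 1)"
  proof (induction m)
    case (Suc m)
    have "a (Suc m) \<le> 1 / (2 * real m + 1) * ((2 * real m + 1) / (2 * real m + 2))\<^sup>2"
      unfolding rec by (rule mult_right_mono[OF Suc]) simp
    also have "\<dots> = (2 * real m + 1) / (2 * real m + 2)\<^sup>2"
      by (simp add: power2_eq_square)
    also have "\<dots> \<le> 1 / (2 * real m + 3)"
      by (simp add: divide_simps power2_eq_square) (simp add: algebra_simps)
    finally show ?case by (simp add: algebra_simps)
  qed (simp add: a_def)
  then show "(real ((2 * m) choose m) / 4 ^ m)\<^sup>2 \<le> 1 / (2 * real m + 1)" by (simp add: a_def)
  have "a m \<ge> 1 / (4 * real m + 1)"
  proof (induction m)
    case (Suc m)
    have "1 / (4 * real m + 5) \<le> 1 / (4 * real m + 1) * ((2 * real m + 1) / (2 * real m + 2))\<^sup>2"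
      by (simp add: divide_simps power2_eq_square add_pos_nonneg) (simp add: algebra_simps)
    also have "\<dots> \<le> a (Suc m)"
      unfolding rec by (rule mult_right_mono[OF Suc]) simp
    finally show ?case by (simp add: algebra_simps)
  qed (simp add: a_def)
  then show "(real ((2 * m) choose m) / 4 ^ m)\<^sup>2 \<ge> 1 / (4 * real m + 1)" by (simp add: a_def)
qed

text \<open>The central coefficient dominates the row. An odd row 2m + 1 reduces to the even row 2m
  + 2, because normalising by powers of 2 makes their central values equal.\<close>

lemma bwalk_sq_le: "(bwalk n y)\<^sup>2 \<le> 1 / (real n + 1)"
proof -
  have le: "bwalk n y \<le> real (n choose (n div 2)) / 2 ^ n"
    unfolding bwalk_closed by (auto intro!: divide_right_mono binomial_maximum)
  have "(real (n choose (n div 2)) / 2 ^ n)\<^sup>2 \<le> 1 / (real n + 1)"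
  proof (cases "even n")
    case True
    then obtain m where m: "n = 2 * m" by blast
    then show ?thesis using central_binomial_sq_bounds(1)[of m] by (simp add: power_mult)
  next
    case False
    then obtain m where m: "n = Suc (2 * m)" using oddE by fastforce
    have s: "Suc (2 * m) choose m = Suc (2 * m) choose Suc m"
      by (subst binomial_symmetric) auto
    have "(2 * Suc m) choose Suc m = 2 * (Suc (2 * m) choose m)"
      using s by simp
    then have "real (n choose (n div 2)) / 2 ^ n = real ((2 * Suc m) choose Suc m) / 4 ^ Suc m"
      unfolding m by (simp add: power_mult)
    then have "(real (n choose (n div 2)) / 2 ^ n)\<^sup>2 \<le> 1 / (2 * real (Suc m) + 1)"
      using central_binomial_sq_bounds(1)[of "Suc m"] by simp
    also have "\<dots> \<le> 1 / (real n + 1)" unfolding m by (simp add: frac_le)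
    finally show ?thesis .
  qed
  then show ?thesis
    using power_mono[OF le bwalk_nonneg, of 2] by linarith
qed

definition plane_walk :: "nat \<Rightarrow> int \<Rightarrow> int \<Rightarrow> real" where
  "plane_walk n a b = bwalk n (a + b) * bwalk n (a - b)"

lemma plane_walk_nonneg: "plane_walk n a b \<ge> 0"
  by (simp add: plane_walk_def bwalk_nonneg)

lemma plane_walk_Suc:
  "plane_walk (Suc n) a b =
     (plane_walk n (a - 1) b + plane_walk n (a + 1) b + plane_walk n a (b - 1) + plane_walk n a (b + 1)) / 4"
  by (simp add: plane_walk_def algebra_simps)

lemma plane_walk_le: "plane_walk n a b \<le> 1 / (real n + 1)"
proof -
  have "2 * (bwalk n (a + b) * bwalk n (a - b)) \<le> (bwalk n (a + b))\<^sup>2 + (bwalk n (a - b))\<^sup>2"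
    using sum_squares_bound[of "bwalk n (a + b)" "bwalk n (a - b)"] by simp
  then show ?thesis using bwalk_sq_le[of n "a + b"] bwalk_sq_le[of n "a - b"]
    unfolding plane_walk_def by linarith
qed

text \<open>The denominator has the shape 2 (j + 1) with j = 2m so that
  \<open>binomial_div_consecutive\<close> serves the lower bound for the heat kernel as well as the
  upper one.\<close>

lemma plane_walk_return_ge: "plane_walk (2 * m) 0 0 \<ge> 1 / (2 * (real (2 * m) + 1))"
proof -
  have "plane_walk (2 * m) 0 0 = (real ((2 * m) choose m) / 4 ^ m)\<^sup>2"
    by (simp add: plane_walk_def bwalk_closed power2_eq_square power_mult)
  moreover have "1 / (2 * (real (2 * m) + 1)) \<le> 1 / (4 * real m + 1)"
    by (simp add: frac_le)
  ultimately show ?thesis using central_binomial_sq_bounds(2)[of m] by linarith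
qed

text \<open>Pascal's rule, arranged for one more step of the walk: it lengthens one of the two
  planar walks, according to the pair of coordinates that moves.\<close>

lemma sum_binomial_Suc:
  fixes f :: "nat \<Rightarrow> nat \<Rightarrow> real"
  shows "(\<Sum>j\<le>Suc n. real (Suc n choose j) * f j (Suc n - j)) =
         (\<Sum>j\<le>n. real (n choose j) * (f (Suc j) (n - j) + f j (Suc (n - j))))"
proof -
  have "(\<Sum>j\<le>Suc n. real (Suc n choose j) * f j (Suc n - j)) =
      f 0 (Suc n) + (\<Sum>j\<le>n. real (Suc n choose Suc j) * f (Suc j) (n - j))"
    by (subst sum.atMost_Suc_shift) simp
  also have "\<dots> = f 0 (Suc n) + (\<Sum>j\<le>n. real (n choose Suc j) * f (Suc j) (n - j)) + (\<Sum>j\<le>n. real (n choose j) * f (Suc j) (n - j))"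
    by (simp add: sum.distrib algebra_simps)
  also have "f 0 (Suc n) + (\<Sum>j\<le>n. real (n choose Suc j) * f (Suc j) (n - j)) = (\<Sum>j\<le>Suc n. real (n choose j) * f j (Suc n - j))"
    by (subst sum.atMost_Suc_shift) simp
  also have "\<dots> = (\<Sum>j\<le>n. real (n choose j) * f j (Suc (n - j)))"
    by (simp add: Suc_diff_le)
  finally show ?thesis by (simp add: sum.distrib algebra_simps)
qed

section \<open>Step sequences and transition probabilities\<close>

definition unit_steps :: "(int ^ 4) set" where
  "unit_steps = {u. zadj 0 u}"

lemma zadj_4: "zadj x y \<longleftrightarrow> \<bar>x $ 1 - y $ 1\<bar> + \<bar>x $ 2 - y $ 2\<bar> + \<bar>x $ 3 - y $ 3\<bar> + \<bar>x $ (4::4) - y $ 4\<bar> = 1"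
  by (simp add: zadj_def sum_4)

lemma unit_steps_eq:
  "unit_steps = {axis 1 1, axis 1 (-1), axis 2 1, axis 2 (-1), axis 3 1, axis 3 (-1), axis 4 1, axis 4 (-1)}"
    (is "_ = ?R")
proof
  show "?R \<subseteq> unit_steps"
    by (auto simp: unit_steps_def zadj_4 axis_def)
  show "unit_steps \<subseteq> ?R"
  proof
    fix u :: "int ^ 4" assume "u \<in> unit_steps"
    then have h: "\<bar>u $ 1\<bar> + \<bar>u $ 2\<bar> + \<bar>u $ 3\<bar> + \<bar>u $ 4\<bar> = 1" by (simp add: unit_steps_def zadj_4)
    have "(u $ 1 = 1 \<and> u $ 2 = 0 \<and> u $ 3 = 0 \<and> u $ 4 = 0) \<or> (u $ 1 = -1 \<and> u $ 2 = 0 \<and> u $ 3 = 0 \<and> u $ 4 = 0) \<or>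
          (u $ 1 = 0 \<and> u $ 2 = 1 \<and> u $ 3 = 0 \<and> u $ 4 = 0) \<or> (u $ 1 = 0 \<and> u $ 2 = -1 \<and> u $ 3 = 0 \<and> u $ 4 = 0) \<or>
          (u $ 1 = 0 \<and> u $ 2 = 0 \<and> u $ 3 = 1 \<and> u $ 4 = 0) \<or> (u $ 1 = 0 \<and> u $ 2 = 0 \<and> u $ 3 = -1 \<and> u $ 4 = 0) \<or>
          (u $ 1 = 0 \<and> u $ 2 = 0 \<and> u $ 3 = 0 \<and> u $ 4 = 1) \<or> (u $ 1 = 0 \<and> u $ 2 = 0 \<and> u $ 3 = 0 \<and> u $ 4 = -1)"
    proof -
      have a: "u $ i = -1 \<or> u $ i = 0 \<or> u $ i = 1" for i
      proof -
        have "\<bar>u $ i\<bar> \<le> 1" using h exhaust_4[of i] by auto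
        then show ?thesis by auto
      qed
      show ?thesis using a[of 1] a[of 2] a[of 3] a[of 4] h by (elim disjE) simp_all
    qed
    then show "u \<in> ?R" by (simp add: vec_eq_iff forall_4 axis_def)
  qed
qed

lemma finite_unit_steps: "finite unit_steps"
  by (simp add: unit_steps_eq)

lemma sum_unit_steps:
  "sum f unit_steps = f (axis 1 1) + f (axis 1 (-1)) + f (axis 2 1) + f (axis 2 (-1)) + f (axis 3 1) + f (axis 3 (-1))
     + f (axis 4 1) + f (axis 4 (-1) :: int ^ 4)" for f :: "_ \<Rightarrow> real"
  unfolding unit_steps_eq by (simp add: axis_eq_axis)

definition steps :: "nat \<Rightarrow> (int ^ 4) list set" where
  "steps n = {s. set s \<subseteq> unit_steps \<and> length s = n}"

text \<open>The n-step transition probability as a normalised cardinality, so that cutting and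
  rotating walks become bijections between finite sets.\<close>

definition heat :: "nat \<Rightarrow> int ^ 4 \<Rightarrow> real" where
  "heat n x = real (card {s \<in> steps n. sum_list s = x}) / 8 ^ n"

lemma finite_steps: "finite (steps n)"
  unfolding steps_def by (rule finite_lists_length_eq[OF finite_unit_steps])

lemma heat_nonneg: "heat n x \<ge> 0"
  by (simp add: heat_def)

lemma heat_0: "heat 0 x = of_bool (x = 0)"
proof -
  have "{s \<in> steps 0. sum_list s = x} = (if x = 0 then {[]} else {})"
    by (auto simp: steps_def)
  then show ?thesis by (simp add: heat_def)
qed

lemma heat_Suc: "heat (Suc n) x = (\<Sum>u\<in>unit_steps. heat n (x - u)) / 8"
proof -
  have "{s \<in> steps (Suc n). sum_list s = x} = (\<Union>u\<in>unit_steps. (#) u ` {s \<in> steps n. sum_list s = x - u})"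
    (is "?L = ?R")
  proof
    show "?L \<subseteq> ?R"
    proof
      fix s assume s: "s \<in> ?L"
      then obtain u t where st: "s = u # t" by (cases s) (auto simp: steps_def)
      then have "t \<in> {s \<in> steps n. sum_list s = x - u}" "u \<in> unit_steps"
        using s by (auto simp: steps_def)
      then show "s \<in> ?R" using st by blast
    qed
    show "?R \<subseteq> ?L" by (auto simp: steps_def)
  qed
  then have "card {s \<in> steps (Suc n). sum_list s = x} = (\<Sum>u\<in>unit_steps. card ((#) u ` {s \<in> steps n. sum_list s = x - u}))"
    by (simp only:) (subst card_UN_disjoint, auto simp: finite_unit_steps finite_steps)
  also have "\<dots> = (\<Sum>u\<in>unit_steps. card {s \<in> steps n. sum_list s = x - u})"
    by (intro sum.cong card_image refl) (auto simp: inj_on_def)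
  finally show ?thesis by (simp add: heat_def sum_divide_distrib mult.commute)
qed

text \<open>Each step moves in the first or in the last two coordinates with probability $1/2$, and
  simple random walk in the plane is a product of two walks on the line after a rotation by $45$ degrees.\<close>

lemma heat_eq:
  "heat n x = (\<Sum>j\<le>n. real (n choose j) * (plane_walk j (x $ 1) (x $ 2) * plane_walk (n - j) (x $ 3) (x $ 4))) / 2 ^ n"
proof (induction n arbitrary: x)
  case 0
  show ?case unfolding heat_0 by (auto simp: plane_walk_def vec_eq_iff forall_4)
next
  case (Suc n)
  let ?p = "\<lambda>j. plane_walk j (x $ 1) (x $ 2)" and ?q = "\<lambda>j. plane_walk j (x $ 3) (x $ 4)"
  have "heat (Suc n) x = (\<Sum>j\<le>n. real (n choose j) * (?p (Suc j) * ?q (n - j) + ?p j * ?q (Suc (n - j)))) / 2 ^ Suc n"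
    unfolding heat_Suc Suc.IH sum_unit_steps sum_divide_distrib[symmetric] add_divide_distrib[symmetric] sum.distrib[symmetric]
    unfolding plane_walk_Suc
    by (simp add: axis_def sum_divide_distrib) (rule sum.cong, auto simp: field_simps)
  then show ?case by (simp only: sum_binomial_Suc[where f = "\<lambda>a b. ?p a * ?q b"])
qed

text \<open>The planar bounds contribute the two denominators. Absorbing both into the binomial
  coefficient turns the average over the time split into a piece of the row sum of order n +
  2.\<close>

lemma binomial_div_consecutive:
  assumes "j \<le> n"
  shows "real (n choose j) / ((real j + 1) * (real (n - j) + 1)) = real ((n + 2) choose (j + 1)) / ((real n + 1) * (real n + 2))"
proof -
  have 1: "Suc j * (Suc (Suc n) choose Suc j) = Suc (Suc n) * (Suc n choose j)"
    by (rule Suc_times_binomial)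
  have 2: "Suc n * (n choose j) = (Suc n - j) * (Suc n choose j)"
    using binomial_absorb_comp[of "Suc n" j] by simp
  have h1: "(real j + 1) * real ((n + 2) choose (j + 1)) = (real n + 2) * real (Suc n choose j)"
    using arg_cong[OF 1, of real] by (simp add: algebra_simps)
  have h2: "(real n + 1) * real (n choose j) = (real (n - j) + 1) * real (Suc n choose j)"
    using arg_cong[OF 2, of real] unfolding Suc_diff_le[OF assms] of_nat_mult of_nat_Suc by (simp only: add.commute)
  have pos: "real j + 1 > 0" "real (n - j) + 1 > 0" "real n + 1 > 0" "real n + 2 > 0" by simp_all
  have "real (n choose j) * ((real n + 1) * (real n + 2)) = real ((n + 2) choose (j + 1)) * ((real j + 1) * (real (n - j) + 1))"
    using h1 h2 by algebra
  then show ?thesis using pos by (simp add: frac_eq_eq)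
qed

text \<open>The product of consecutive integers is kept because it telescopes when summed over
  time.\<close>

lemma heat_le: "heat n x \<le> 4 / ((real n + 1) * (real n + 2))"
proof -
  have "(\<Sum>j\<le>n. real (n choose j) * (plane_walk j (x $ 1) (x $ 2) * plane_walk (n - j) (x $ 3) (x $ 4)))
      \<le> (\<Sum>j\<le>n. real (n choose j) * (1 / (real j + 1) * (1 / (real (n - j) + 1))))"
    by (intro sum_mono mult_left_mono mult_mono plane_walk_le plane_walk_nonneg) auto
  also have "\<dots> = (\<Sum>j\<le>n. real ((n + 2) choose (j + 1)) / ((real n + 1) * (real n + 2)))"
  proof (intro sum.cong refl)
    fix j assume "j \<in> {..n}"
    then have "j \<le> n" by simp
    from binomial_div_consecutive[OF this]
    show "real (n choose j) * (1 / (real j + 1) * (1 / (real (n - j) + 1))) =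
        real ((n + 2) choose (j + 1)) / ((real n + 1) * (real n + 2))"
      by (simp only: mult_1_left times_divide_times_eq times_divide_eq_right mult_1_right divide_divide_eq_left)
  qed
  also have "\<dots> = (\<Sum>j\<le>n. real ((n + 2) choose (j + 1))) / ((real n + 1) * (real n + 2))"
    by (simp add: sum_divide_distrib)
  also have "\<dots> \<le> 2 ^ (n + 2) / ((real n + 1) * (real n + 2))"
  proof (rule divide_right_mono)
    have "(\<Sum>j\<le>n. ((n + 2) choose (j + 1))) = (\<Sum>j\<in>Suc ` {..n}. ((n + 2) choose j))"
      by (subst sum.reindex) auto
    also have "\<dots> \<le> (\<Sum>j\<le>n+2. ((n + 2) choose j))"
      by (rule sum_mono2) auto
    also have "\<dots> = 2 ^ (n + 2)" by (rule choose_row_sum)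
    finally show "(\<Sum>j\<le>n. real ((n + 2) choose (j + 1))) \<le> 2 ^ (n + 2)"
      by (metis of_nat_le_iff of_nat_numeral of_nat_power of_nat_sum)
  qed simp
  finally show ?thesis unfolding heat_eq by (simp add: field_simps)
qed

lemma heat_return_ge:
  assumes "n \<ge> 1"
  shows "heat (2 * n) 0 \<ge> 1 / (6 * (real (2 * n))\<^sup>2)"
proof -
  let ?N = "2 * n"
  \<comment> \<open>Only even time splits allow both planar walks to return. They correspond to the
    odd entries of row N + 2, which carry half of the row sum.\<close>
  have "1 / 4 * 2 ^ (?N + 1) / ((real ?N + 1) * (real ?N + 2))
     = (\<Sum>i\<le>n. real ((?N + 2) choose (2 * i + 1))) / 4 / ((real ?N + 1) * (real ?N + 2))"
  proof -
    have "2 * (\<Sum>i\<in>{i \<in> {..?N + 2}. odd i}. real ((?N + 2) choose i)) = 2 ^ (?N + 2)"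
      using choose_odd_sum[of "?N + 2", where 'a = real] by (subst sum.inter_filter) auto
    moreover have "(\<Sum>i\<in>{i \<in> {..?N + 2}. odd i}. real ((?N + 2) choose i)) = (\<Sum>i\<le>n. real ((?N + 2) choose (2 * i + 1)))"
    proof -
      have *: "{i \<in> {..?N + 2}. odd i} = (\<lambda>i. 2 * i + 1) ` {..n}" by (auto elim!: oddE)
      show ?thesis unfolding * by (subst sum.reindex) (auto simp: inj_on_def)
    qed
    ultimately show ?thesis by simp
  qed
  also have "\<dots> = (\<Sum>i\<le>n. real (?N choose (2 * i)) * (1 / (2 * (real (2 * i) + 1)) * (1 / (2 * (real (2 * (n - i)) + 1)))))"
    unfolding sum_divide_distrib
  proof (intro sum.cong refl)
    fix i assume "i \<in> {..n}"
    then have i: "2 * i \<le> ?N" "?N - 2 * i = 2 * (n - i)" by auto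
    show "real ((?N + 2) choose (2 * i + 1)) / 4 / ((real ?N + 1) * (real ?N + 2)) =
       real (?N choose (2 * i)) * (1 / (2 * (real (2 * i) + 1)) * (1 / (2 * (real (2 * (n - i)) + 1))))"
    proof -
      have gen: "A / (a * b) = X / Y \<Longrightarrow> X / 4 / Y = A * (1 / (2 * a) * (1 / (2 * b)))" for A a b X Y :: real
        by (simp add: mult.assoc mult.left_commute)
      show ?thesis using binomial_div_consecutive[OF i(1)] unfolding i(2) by (rule gen)
    qed
  qed
  also have "\<dots> \<le> (\<Sum>i\<le>n. real (?N choose (2 * i)) * (plane_walk (2 * i) 0 0 * plane_walk (2 * (n - i)) 0 0))"
    by (intro sum_mono mult_left_mono mult_mono plane_walk_return_ge plane_walk_nonneg) auto
  also have "\<dots> = (\<Sum>j\<in>(*) 2 ` {..n}. real (?N choose j) * (plane_walk j 0 0 * plane_walk (?N - j) 0 0))"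
    by (subst sum.reindex) (auto simp: inj_on_def right_diff_distrib')
  also have "\<dots> \<le> (\<Sum>j\<le>?N. real (?N choose j) * (plane_walk j 0 0 * plane_walk (?N - j) 0 0))"
    by (rule sum_mono2) (auto simp: plane_walk_nonneg)
  also have "\<dots> = heat ?N 0 * 2 ^ ?N" by (simp add: heat_eq)
  finally have "1 / (2 * ((real ?N + 1) * (real ?N + 2))) * 2 ^ ?N \<le> heat ?N 0 * 2 ^ ?N"
    by (simp add: field_simps)
  then have "1 / (2 * ((real ?N + 1) * (real ?N + 2))) \<le> heat ?N 0"
    by (rule mult_right_le_imp_le) simp
  \<comment> \<open>The constant 6 is dictated by the shortest case N = 2, where both sides
    agree.\<close>
  moreover have "1 / (6 * (real ?N)\<^sup>2) \<le> 1 / (2 * ((real ?N + 1) * (real ?N + 2)))"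
  proof (rule divide_left_mono)
    have "1 * 1 \<le> real n * real n" using assms by (intro mult_mono) auto
    moreover have "1 * real n \<le> real n * real n" using assms by (intro mult_right_mono) auto
    ultimately show "2 * ((real ?N + 1) * (real ?N + 2)) \<le> 6 * (real ?N)\<^sup>2"
      by (simp add: power2_eq_square algebra_simps)
  qed (use assms in auto)
  ultimately show ?thesis by linarith
qed

subsection \<open>Closed walks and their energy\<close>

lemma bwalk_minus: "bwalk n (- y) = bwalk n y"
proof (induction n arbitrary: y)
  case (Suc n)
  show ?case using Suc.IH[of "y + 1"] Suc.IH[of "y - 1"] by simp
qed simp

lemma heat_minus: "heat n (- x) = heat n x"
proof -
  have "plane_walk j (- a) (- b) = plane_walk j a b" for j a b
    using bwalk_minus[of j "a + b"] bwalk_minus[of j "a - b"] by (simp add: plane_walk_def)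
  then show ?thesis by (simp add: heat_eq)
qed

lemma heat_le_sq: "heat n x \<le> 4 / (real n + 1)\<^sup>2"
proof -
  have "4 / ((real n + 1) * (real n + 2)) \<le> 4 / (real n + 1)\<^sup>2"
    by (intro divide_left_mono) (auto simp: power2_eq_square)
  then show ?thesis using heat_le[of n x] by linarith
qed

lemma heat_tail_sums: "(\<lambda>l. 4 / ((real (m + l) + 1) * (real (m + l) + 2))) sums (4 / (real m + 1))"
proof -
  have "(\<lambda>l. 4 / (real (m + l) + 1)) \<longlonglongrightarrow> 0"
    by real_asymp
  from telescope_sums'[OF this]
  have "(\<lambda>l. 4 / (real (m + l) + 1) - 4 / (real (m + Suc l) + 1)) sums (4 / (real m + 1))" by simp
  moreover have "4 / (real (m + l) + 1) - 4 / (real (m + Suc l) + 1) = 4 / ((real (m + l) + 1) * (real (m + l) + 2))" for l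
    by (simp add: divide_simps add_nonneg_eq_0_iff) 
  ultimately show ?thesis by (simp only:)
qed

lemma summable_heat_shift: "summable (\<lambda>l. heat (m + l) x)"
proof (rule summable_comparison_test'[OF sums_summable[OF heat_tail_sums[of m]], of 0])
  show "norm (heat (m + l) x) \<le> 4 / ((real (m + l) + 1) * (real (m + l) + 2))" for l
    using heat_le[of "m + l" x] heat_nonneg[of "m + l" x] by simp
qed

lemma suminf_heat_shift_le: "(\<Sum>l. heat (m + l) x) \<le> 4 / (real m + 1)"
  using suminf_le[OF heat_le summable_heat_shift sums_summable[OF heat_tail_sums[of m]]]
  by (simp only: sums_unique[OF heat_tail_sums[of m], symmetric])

section \<open>Green function and the Markov property\<close>

definition green :: "int ^ 4 \<Rightarrow> real" where
  "green x = (\<Sum>l. heat l x)"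

lemma summable_heat: "summable (\<lambda>l. heat l x)"
  using summable_heat_shift[of 0] by simp

lemma green_le: "green x \<le> 4"
  using suminf_heat_shift_le[of 0 x] by (simp add: green_def)

lemma sum_heat_le_green: "(\<Sum>l\<in>A. heat l x) \<le> green x" if "finite A"
  unfolding green_def by (rule sum_le_suminf[OF summable_heat that]) (simp add: heat_nonneg)

lemma green_nonneg: "green x \<ge> 0"
  using sum_heat_le_green[of "{}"] by simp

lemma green_0_ge: "green 0 \<ge> 1"
  using sum_heat_le_green[of "{0}" 0] by (simp add: heat_0)

definition part :: "(int ^ 4) list \<Rightarrow> nat \<Rightarrow> int ^ 4" where
  "part s i = sum_list (take i s)"

lemma card_steps_split:
  assumes "m \<le> n"
  shows "real (card {s \<in> steps n. sum_list s = x \<and> part s m = z}) = 8 ^ n * (heat m z * heat (n - m) (x - z))"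
proof -
  let ?A = "{s \<in> steps m. sum_list s = z}" and ?B = "{s \<in> steps (n - m). sum_list s = x - z}"
  have "bij_betw (\<lambda>(a, b). a @ b) (?A \<times> ?B) {s \<in> steps n. sum_list s = x \<and> part s m = z}"
  proof (rule bij_betwI[where g = "\<lambda>s. (take m s, drop m s)"])
    show "(\<lambda>(a, b). a @ b) \<in> ?A \<times> ?B \<rightarrow> {s \<in> steps n. sum_list s = x \<and> part s m = z}"
      using assms by (auto simp: steps_def part_def)
    show "(\<lambda>s. (take m s, drop m s)) \<in> {s \<in> steps n. sum_list s = x \<and> part s m = z} \<rightarrow> ?A \<times> ?B"
    proof
      fix s assume s: "s \<in> {s \<in> steps n. sum_list s = x \<and> part s m = z}"
      have "sum_list (take m s) + sum_list (drop m s) = sum_list s"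
        by (metis append_take_drop_id sum_list_append)
      then show "(take m s, drop m s) \<in> ?A \<times> ?B"
        using s assms by (auto simp: steps_def part_def algebra_simps dest: in_set_takeD in_set_dropD)
    qed
  qed (auto simp: steps_def)
  from bij_betw_same_card[OF this]
  have "card {s \<in> steps n. sum_list s = x \<and> part s m = z} = card ?A * card ?B"
    by (simp only: card_cartesian_product)
  moreover have "(8::real) ^ n = 8 ^ m * 8 ^ (n - m)" using assms by (simp add: power_add[symmetric])
  ultimately show ?thesis by (simp add: heat_def)
qed

text \<open>Symmetry of the kernel makes each product a closed walk passing \<open>z\<close> at time
  \<open>m\<close>. Allowing only finitely many \<open>z\<close> gives an inequality and avoids sums
  over the whole lattice.\<close>

lemma sum_heat_convolution_le:
  assumes "finite B"
  shows "(\<Sum>z\<in>B. heat m z * heat l z) \<le> heat (m + l) 0"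
proof -
  let ?S = "\<lambda>z. {s \<in> steps (m + l). sum_list s = 0 \<and> part s m = z}"
  have "8 ^ (m + l) * (\<Sum>z\<in>B. heat m z * heat l z) = (\<Sum>z\<in>B. real (card (?S z)))"
    using card_steps_split[of m "m + l" 0] by (simp add: sum_distrib_left heat_minus)
  also have "\<dots> = real (card (\<Union>z\<in>B. ?S z))"
    by (subst card_UN_disjoint) (auto simp: assms finite_steps)
  also have "\<dots> \<le> real (card {s \<in> steps (m + l). sum_list s = 0})"
    by (intro of_nat_mono card_mono) (auto simp: finite_steps)
  finally show ?thesis unfolding heat_def[of "m + l" 0] by (simp add: field_simps)
qed

text \<open>The mean of the Green function at time \<open>m\<close> is at most the sum of the return
  probabilities from time \<open>m\<close> on. Its decay like 1 / m is the critical one.\<close>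

lemma sum_heat_green_le:
  assumes "finite B"
  shows "(\<Sum>z\<in>B. heat m z * green z) \<le> 4 / (real m + 1)"
proof -
  have "(\<Sum>z\<in>B. heat m z * green z) = (\<Sum>z\<in>B. \<Sum>l. heat m z * heat l z)"
    unfolding green_def by (simp add: suminf_mult[OF summable_heat])
  also have "\<dots> = (\<Sum>l. \<Sum>z\<in>B. heat m z * heat l z)"
    by (rule suminf_sum[symmetric]) (intro summable_mult summable_heat)
  also have "\<dots> \<le> (\<Sum>l. heat (m + l) 0)"
  proof (rule suminf_le)
    show "summable (\<lambda>l. \<Sum>z\<in>B. heat m z * heat l z)"
      by (rule summable_sum) (rule summable_mult[OF summable_heat])
  qed (rule sum_heat_convolution_le[OF assms] summable_heat_shift)+
  also have "\<dots> \<le> 4 / (real m + 1)" by (rule suminf_heat_shift_le)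
  finally show ?thesis .
qed

section \<open>Closed walks and cyclic shifts\<close>

definition closed_steps :: "nat \<Rightarrow> (int ^ 4) list set" where
  "closed_steps n = {s \<in> steps n. sum_list s = 0}"

lemma finite_closed_steps: "finite (closed_steps n)"
  by (simp add: closed_steps_def finite_steps)

lemma card_closed_steps: "real (card (closed_steps n)) = 8 ^ n * heat n 0"
  by (simp add: closed_steps_def heat_def)

text \<open>Rotation permutes the closed step sequences. Increments of a uniformly chosen closed
  walk are therefore stationary, and any pair of times can be shifted so that the earlier one is
  0.\<close>

lemma card_closed_steps_rotate:
  assumes "i \<le> n"
  shows "card {s \<in> closed_steps n. P (rotate i s)} = card {s \<in> closed_steps n. P s}"
proof -
  have inj: "inj_on (rotate i) (closed_steps n)"
    by (rule inj_on_inverseI[where g = "rotate (n - i)"])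
      (use assms in \<open>simp add: rotate_rotate closed_steps_def steps_def\<close>)
  have into: "rotate i ` closed_steps n \<subseteq> closed_steps n"
  proof
    fix t assume "t \<in> rotate i ` closed_steps n"
    then obtain s where s: "s \<in> closed_steps n" "t = rotate i s" by blast
    have "sum_list (rotate i s) = sum_list s"
      unfolding rotate_drop_take sum_list_append
      by (subst add.commute) (simp flip: sum_list_append)
    then show "t \<in> closed_steps n" using s by (simp add: closed_steps_def steps_def)
  qed
  then have onto: "rotate i ` closed_steps n = closed_steps n"
    by (intro endo_inj_surj finite_closed_steps inj)
  have "rotate i ` {s \<in> closed_steps n. P (rotate i s)} = {s \<in> closed_steps n. P s}"
  proof
    show "{s \<in> closed_steps n. P s} \<subseteq> rotate i ` {s \<in> closed_steps n. P (rotate i s)}"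
    proof
      fix t assume t: "t \<in> {s \<in> closed_steps n. P s}"
      then obtain s where "s \<in> closed_steps n" "t = rotate i s" using onto by blast
      then show "t \<in> rotate i ` {s \<in> closed_steps n. P (rotate i s)}" using t by blast
    qed
  qed (use into in auto)
  moreover have "inj_on (rotate i) {s \<in> closed_steps n. P (rotate i s)}"
    by (rule inj_on_subset[OF inj]) auto
  ultimately show ?thesis using card_image by fastforce
qed

lemma part_rotate:
  assumes "i \<le> j" "j \<le> length s"
  shows "part (rotate i s) (j - i) = part s j - part s i"
proof -
  have "rotate i s = drop i s @ take i s"
  proof (cases "i = length s")
    case False
    then show ?thesis using assms by (simp add: rotate_drop_take)
  qed simp
  then have "part (rotate i s) (j - i) = sum_list (take (j - i) (drop i s))"
    using assms by (simp add: part_def)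
  moreover have "take j s = take i s @ take (j - i) (drop i s)"
    using assms by (metis le_add_diff_inverse take_add)
  ultimately show ?thesis by (simp add: part_def)
qed

text \<open>One of the two truncated differences is always 0, so this is the absolute difference
  without leaving the naturals.\<close>

definition idist :: "nat \<Rightarrow> nat \<Rightarrow> nat" where
  "idist i j = (i - j) + (j - i)"

lemma card_closed_steps_increment:
  assumes "i \<le> n" "j \<le> n"
  shows "real (card {s \<in> closed_steps n. part s i - part s j = z}) =
     8 ^ n * (heat (idist i j) z * heat (n - idist i j) z)"
proof -
  have main: "real (card {s \<in> closed_steps n. part s j - part s i = z}) = 8 ^ n * (heat (j - i) z * heat (n - (j - i)) z)"
    if "i \<le> j" "j \<le> n" for i j z
  proof -
    have "{s \<in> closed_steps n. part s j - part s i = z} = {s \<in> closed_steps n. part (rotate i s) (j - i) = z}"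
      using that part_rotate[of i j] by (auto simp: closed_steps_def steps_def)
    then have "card {s \<in> closed_steps n. part s j - part s i = z} = card {s \<in> closed_steps n. part s (j - i) = z}"
      using card_closed_steps_rotate[of i n "\<lambda>s. part s (j - i) = z"] that by simp
    also have "{s \<in> closed_steps n. part s (j - i) = z} = {s \<in> steps n. sum_list s = 0 \<and> part s (j - i) = z}"
      by (auto simp: closed_steps_def)
    finally show ?thesis using card_steps_split[of "j - i" n 0 z] that by (simp add: heat_minus)
  qed
  show ?thesis
  proof (cases "j \<le> i")
    case True
    then show ?thesis using main[of j i z] assms by (simp add: idist_def)
  next
    case False
    have "part s i - part s j = z \<longleftrightarrow> part s j - part s i = - z" for s
      using neg_equal_iff_equal[of "part s i - part s j" z] by simp
    then show ?thesis using main[of i j "- z"] assms False by (simp add: idist_def heat_minus)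
  qed
qed

text \<open>One of the arcs takes at least n / 2 steps, and its kernel is at most 4 / (n / 2)^2 = 16
  / n^2. The kernel of the other arc survives, as for a walk that is not forced to close up.\<close>

lemma heat_mult_heat_le:
  assumes "m \<le> n" "n \<ge> 1"
  shows "heat m z * heat (n - m) z \<le> 16 / (real n)\<^sup>2 * (heat m z + heat (n - m) z)"
proof -
  have small: "heat k z \<le> 16 / (real n)\<^sup>2" if "n \<le> 2 * k" for k
  proof -
    have "(real n / 2)\<^sup>2 \<le> (real k + 1)\<^sup>2" using that by (intro power_mono) auto
    then have "4 / (real k + 1)\<^sup>2 \<le> 4 / (real n / 2)\<^sup>2"
      using assms by (intro divide_left_mono) auto
    then show ?thesis using heat_le_sq[of k z] by (simp add: power_divide)
  qed
  have pos: "16 / (real n)\<^sup>2 \<ge> 0" by simp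
  consider "n \<le> 2 * m" | "n \<le> 2 * (n - m)" using assms by linarith
  then show ?thesis
  proof cases
    case 1
    have "heat m z * heat (n - m) z \<le> 16 / (real n)\<^sup>2 * heat (n - m) z"
      by (rule mult_right_mono[OF small[OF 1] heat_nonneg])
    also have "\<dots> \<le> 16 / (real n)\<^sup>2 * (heat m z + heat (n - m) z)"
      by (rule mult_left_mono[OF _ pos]) (simp add: heat_nonneg)
    finally show ?thesis .
  next
    case 2
    have "heat m z * heat (n - m) z \<le> heat m z * (16 / (real n)\<^sup>2)"
      by (rule mult_left_mono[OF small[OF 2] heat_nonneg])
    also have "\<dots> \<le> (heat m z + heat (n - m) z) * (16 / (real n)\<^sup>2)"
      by (rule mult_right_mono[OF _ pos]) (simp add: heat_nonneg)
    finally show ?thesis by (simp add: mult.commute)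
  qed
qed

text \<open>Every distance from \<open>i\<close> occurs at most once on either side. The
  complementary arcs are covered by the reflection k -> n - k, which is injective up to n.\<close>

lemma sum_idist_le:
  fixes f :: "nat \<Rightarrow> real"
  assumes "\<And>k. f k \<ge> 0" "i < n"
  shows "(\<Sum>j<n. f (idist i j)) \<le> 2 * (\<Sum>k\<le>n. f k)"
    and "(\<Sum>j<n. f (n - idist i j)) \<le> 2 * (\<Sum>k\<le>n. f k)"
proof -
  have gen: "(\<Sum>j<n. f (g (idist i j))) \<le> 2 * (\<Sum>k\<le>n. f k)"
    if g: "inj_on g {..n}" "g ` {..n} \<subseteq> {..n}" for g
  proof -
    have "(\<Sum>j<n. f (g (idist i j))) = (\<Sum>j\<in>{..i}. f (g (idist i j))) + (\<Sum>j\<in>{i<..<n}. f (g (idist i j)))"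
      using assms(2) by (subst sum.union_disjoint[symmetric]) (auto intro!: sum.cong)
    also have "(\<Sum>j\<in>{..i}. f (g (idist i j))) = sum f ((\<lambda>j. g (i - j)) ` {..i})"
    proof (subst sum.reindex)
      show "inj_on (\<lambda>j. g (i - j)) {..i}"
      proof (rule inj_onI)
        fix j k assume "j \<in> {..i}" "k \<in> {..i}" "g (i - j) = g (i - k)"
        moreover from this(3) have "i - j = i - k"
          by (rule inj_onD[OF g(1)]) (use assms(2) in auto)
        ultimately show "j = k" by auto
      qed
    qed (simp add: idist_def)
    also have "(\<Sum>j\<in>{i<..<n}. f (g (idist i j))) = sum f ((\<lambda>j. g (j - i)) ` {i<..<n})"
    proof (subst sum.reindex)
      show "inj_on (\<lambda>j. g (j - i)) {i<..<n}"
      proof (rule inj_onI)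
        fix j k assume "j \<in> {i<..<n}" "k \<in> {i<..<n}" "g (j - i) = g (k - i)"
        moreover from this(3) have "j - i = k - i"
          by (rule inj_onD[OF g(1)]) (use calculation in auto)
        ultimately show "j = k" by auto
      qed
    qed (simp add: idist_def)
    also have "sum f ((\<lambda>j. g (i - j)) ` {..i}) \<le> (\<Sum>k\<le>n. f k)"
      by (rule sum_mono2) (use assms g(2) in \<open>auto simp: image_subset_iff\<close>)
    also have "sum f ((\<lambda>j. g (j - i)) ` {i<..<n}) \<le> (\<Sum>k\<le>n. f k)"
      by (rule sum_mono2) (use assms g(2) in \<open>auto simp: image_subset_iff\<close>)
    finally show ?thesis by simp
  qed
  show "(\<Sum>j<n. f (idist i j)) \<le> 2 * (\<Sum>k\<le>n. f k)" by (rule gen) auto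
  show "(\<Sum>j<n. f (n - idist i j)) \<le> 2 * (\<Sum>k\<le>n. f k)" by (rule gen) (auto simp: inj_on_def)
qed

text \<open>The source of both later estimates: weighted with \<open>green z\<close> it bounds the
  mean energy of a closed walk, and with \<open>z\<close> a difference of two target points it
  bounds the second moment of hits. The constant is 16 times 4 sums, and the n starting times cancel
  one power of n.\<close>

lemma sum_closed_steps_increment_le:
  assumes "n \<ge> 1"
  shows "(\<Sum>i<n. \<Sum>j<n. real (card {s \<in> closed_steps n. part s i - part s j = z}))
    \<le> 8 ^ n * (64 / real n * (\<Sum>k\<le>n. heat k z))"
proof -
  have "(\<Sum>j<n. real (card {s \<in> closed_steps n. part s i - part s j = z}))
    \<le> 8 ^ n * (16 / (real n)\<^sup>2 * (4 * (\<Sum>k\<le>n. heat k z)))" if i: "i < n" for i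
  proof -
    have "(\<Sum>j<n. real (card {s \<in> closed_steps n. part s i - part s j = z}))
       = 8 ^ n * (\<Sum>j<n. heat (idist i j) z * heat (n - idist i j) z)"
      unfolding sum_distrib_left by (intro sum.cong card_closed_steps_increment) (use i in auto)
    also have "\<dots> \<le> 8 ^ n * (\<Sum>j<n. 16 / (real n)\<^sup>2 * (heat (idist i j) z + heat (n - idist i j) z))"
      by (intro mult_left_mono sum_mono heat_mult_heat_le assms) (use i in \<open>auto simp: idist_def\<close>)
    also have "\<dots> = 8 ^ n * (16 / (real n)\<^sup>2 * ((\<Sum>j<n. heat (idist i j) z) + (\<Sum>j<n. heat (n - idist i j) z)))"
      by (simp only: sum_distrib_left[symmetric] sum.distrib)
    also have "\<dots> \<le> 8 ^ n * (16 / (real n)\<^sup>2 * (4 * (\<Sum>k\<le>n. heat k z)))"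
      using sum_idist_le[of "\<lambda>k. heat k z" i n] i by (intro mult_left_mono) (auto simp: heat_nonneg)
    finally show ?thesis .
  qed
  then have "(\<Sum>i<n. \<Sum>j<n. real (card {s \<in> closed_steps n. part s i - part s j = z}))
    \<le> (\<Sum>i<n. 8 ^ n * (16 / (real n)\<^sup>2 * (4 * (\<Sum>k\<le>n. heat k z))))"
    by (intro sum_mono) simp
  also have "\<dots> = 8 ^ n * (64 / real n * (\<Sum>k\<le>n. heat k z))"
    using assms by (simp add: power2_eq_square)
  finally show ?thesis .
qed

text \<open>Positions of the list carry equal mass, so vertices visited often count with
  multiplicity. By the variational principle \<open>1 / energy xs\<close> is a lower bound for the
  capacity of the entries.\<close>

definition energy :: "(int ^ 4) list \<Rightarrow> real" where
  "energy xs = (\<Sum>i<length xs. \<Sum>j<length xs. green (xs ! i - xs ! j)) / (real (length xs))\<^sup>2"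

definition loop_at :: "int ^ 4 \<Rightarrow> (int ^ 4) list \<Rightarrow> (int ^ 4) list" where
  "loop_at x s = map (\<lambda>i. x + part s i) [0..<length s]"

lemma length_loop_at [simp]: "length (loop_at x s) = length s"
  by (simp add: loop_at_def)

lemma nth_loop_at [simp]: "i < length s \<Longrightarrow> loop_at x s ! i = x + part s i"
  by (simp add: loop_at_def)

lemma energy_loop_at:
  "energy (loop_at x s) = (\<Sum>i<length s. \<Sum>j<length s. green (part s i - part s j)) / (real (length s))\<^sup>2"
  by (simp add: energy_def)

lemma energy_pos: "energy xs > 0" if "xs \<noteq> []"
proof -
  have "0 < green (xs ! 0 - xs ! 0)" using green_0_ge by simp
  also have "\<dots> \<le> (\<Sum>j<length xs. green (xs ! 0 - xs ! j))"
    by (rule member_le_sum) (use that in \<open>auto simp: green_nonneg\<close>)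
  also have "\<dots> \<le> (\<Sum>i<length xs. \<Sum>j<length xs. green (xs ! i - xs ! j))"
    by (rule member_le_sum) (use that in \<open>auto simp: green_nonneg sum_nonneg\<close>)
  finally show ?thesis using that by (simp add: energy_def)
qed

lemma sum_swap3:
  fixes f :: "_ \<Rightarrow> _ \<Rightarrow> _ \<Rightarrow> real"
  shows "(\<Sum>i\<in>I. \<Sum>j\<in>J. \<Sum>z\<in>Z. f i j z) = (\<Sum>z\<in>Z. \<Sum>i\<in>I. \<Sum>j\<in>J. f i j z)"
proof -
  have "(\<Sum>i\<in>I. \<Sum>j\<in>J. \<Sum>z\<in>Z. f i j z) = (\<Sum>i\<in>I. \<Sum>z\<in>Z. \<Sum>j\<in>J. f i j z)"
    by (intro sum.cong refl sum.swap)
  also have "\<dots> = (\<Sum>z\<in>Z. \<Sum>i\<in>I. \<Sum>j\<in>J. f i j z)" by (rule sum.swap)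
  finally show ?thesis .
qed

lemma sum_swap4:
  fixes f :: "_ \<Rightarrow> _ \<Rightarrow> _ \<Rightarrow> _ \<Rightarrow> real"
  shows "(\<Sum>s\<in>S. \<Sum>i\<in>I. \<Sum>j\<in>J. \<Sum>z\<in>Z. f s i j z) = (\<Sum>z\<in>Z. \<Sum>i\<in>I. \<Sum>j\<in>J. \<Sum>s\<in>S. f s i j z)"
  unfolding sum_swap3[where Z = Z] sum_swap3[where Z = S] by (rule sum.swap)

lemma sum_closed_steps_energy_le:
  assumes "n \<ge> 1"
  shows "(\<Sum>s\<in>closed_steps n. energy (loop_at 0 s)) \<le> 8 ^ n * (256 / (real n) ^ 3 * (1 + ln (real n + 1)))"
proof -
  \<comment> \<open>All displacements that occur. Inserting a sum over this finite set separates the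
    count of pairs from the Green function.\<close>
  define Z where "Z = (\<lambda>(s, i, j). part s i - part s j) ` (closed_steps n \<times> {..<n} \<times> {..<n})"
  have Z: "finite Z" unfolding Z_def by (intro finite_imageI finite_cartesian_product finite_closed_steps) auto
  have len: "length s = n" if "s \<in> closed_steps n" for s using that by (simp add: closed_steps_def steps_def)
  have "(real n)\<^sup>2 * (\<Sum>s\<in>closed_steps n. energy (loop_at 0 s)) =
      (\<Sum>s\<in>closed_steps n. \<Sum>i<n. \<Sum>j<n. green (part s i - part s j))"
    unfolding sum_distrib_left by (intro sum.cong refl) (use assms in \<open>simp add: energy_loop_at len\<close>)
  also have "\<dots> = (\<Sum>s\<in>closed_steps n. \<Sum>i<n. \<Sum>j<n. \<Sum>z\<in>Z. of_bool (part s i - part s j = z) * green z)"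
  proof (intro sum.cong refl)
    fix s i j assume "s \<in> closed_steps n" "i \<in> {..<n}" "j \<in> {..<n}"
    then have "part s i - part s j \<in> Z" unfolding Z_def by force
    then have "(\<Sum>z\<in>Z. if part s i - part s j = z then green z else 0) = green (part s i - part s j)"
      using Z by simp
    moreover have "(if part s i - part s j = z then green z else 0) = of_bool (part s i - part s j = z) * green z" for z
      by simp
    ultimately show "green (part s i - part s j) = (\<Sum>z\<in>Z. of_bool (part s i - part s j = z) * green z)" by simp
  qed
  also have "\<dots> = (\<Sum>z\<in>Z. (\<Sum>i<n. \<Sum>j<n. \<Sum>s\<in>closed_steps n. of_bool (part s i - part s j = z)) * green z)"
    unfolding sum_distrib_right by (rule sum_swap4)
  also have "\<dots> = (\<Sum>z\<in>Z. (\<Sum>i<n. \<Sum>j<n. real (card {s \<in> closed_steps n. part s i - part s j = z})) * green z)"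
    using sum.inter_filter[OF finite_closed_steps[of n], of "\<lambda>_. 1 :: real"]
    by (simp add: of_bool_def)
  also have "\<dots> \<le> (\<Sum>z\<in>Z. 8 ^ n * (64 / real n * (\<Sum>k\<le>n. heat k z)) * green z)"
    by (intro sum_mono mult_right_mono sum_closed_steps_increment_le assms green_nonneg)
  also have "\<dots> = 8 ^ n * (64 / real n * (\<Sum>k\<le>n. \<Sum>z\<in>Z. heat k z * green z))"
    by (subst sum.swap) (simp add: sum_distrib_left sum_distrib_right mult.assoc)
  also have "\<dots> \<le> 8 ^ n * (64 / real n * (\<Sum>k\<le>n. 4 / (real k + 1)))"
    by (intro mult_left_mono sum_mono sum_heat_green_le Z) auto
  \<comment> \<open>This harmonic sum is where the critical logarithm appears.\<close>
  also have "(\<Sum>k\<le>n. 4 / (real k + 1)) = 4 * harm (Suc n)"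
    unfolding harm_def sum_distrib_left
    by (rule sum.reindex_bij_witness[of _ "\<lambda>k. k - 1" Suc]) (auto simp: divide_inverse add.commute)
  also have "8 ^ n * (64 / real n * (4 * harm (Suc n))) \<le> 8 ^ n * (64 / real n * (4 * (1 + ln (real n + 1))))"
    using euler_mascheroni_sequence_decreasing[of 1 "Suc n"] by (intro mult_left_mono) (auto simp: harm_expand(2) add.commute)
  finally show ?thesis using assms by (simp add: field_simps power2_eq_square power3_eq_cube)
qed

subsection \<open>Loops hitting a set\<close>

lemma linf_norm_le_iff: "linf_norm x \<le> k \<longleftrightarrow> (\<forall>i. \<bar>x $ i\<bar> \<le> k)"
  unfolding linf_norm_def by (subst Max_le_iff) auto

lemma linf_norm_box:
  shows "finite {z :: int ^ 4. linf_norm z \<le> int k}"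
    and "card {z :: int ^ 4. linf_norm z \<le> int k} \<le> (2 * k + 1) ^ 4"
proof -
  have *: "{z :: int ^ 4. linf_norm z \<le> int k} \<subseteq> vec_lambda ` (UNIV \<rightarrow>\<^sub>E {- int k..int k})"
  proof
    fix z :: "int ^ 4" assume z: "z \<in> {z. linf_norm z \<le> int k}"
    have "\<bar>z $ i\<bar> \<le> int k" for i using z by (simp add: linf_norm_le_iff)
    then have "- int k \<le> z $ i \<and> z $ i \<le> int k" for i by (simp add: abs_le_iff minus_le_iff)
    then have "vec_nth z \<in> UNIV \<rightarrow>\<^sub>E {- int k..int k}" by auto
    then show "z \<in> vec_lambda ` (UNIV \<rightarrow>\<^sub>E {- int k..int k})" by (metis imageI vec_nth_inverse)
  qed
  have fin: "finite ((UNIV :: 4 set) \<rightarrow>\<^sub>E {- int k..int k})" by (intro finite_PiE) auto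
  show "finite {z :: int ^ 4. linf_norm z \<le> int k}"
    using * fin finite_subset by blast
  have "card {z :: int ^ 4. linf_norm z \<le> int k} \<le> card ((UNIV :: 4 set) \<rightarrow>\<^sub>E {- int k..int k})"
    using card_mono[OF _ *] card_image_le[OF fin, of vec_lambda] fin by fastforce
  also have "\<dots> = (2 * k + 1) ^ 4"
  proof -
    have "nat (2 * int k + 1) = 2 * k + 1" by simp
    then show ?thesis by (simp add: card_PiE del: One_nat_def)
  qed
  finally show "card {z :: int ^ 4. linf_norm z \<le> int k} \<le> (2 * k + 1) ^ 4" .
qed

section \<open>Counting closed walks of low energy and wide closed walks\<close>

lemma real_card_Diff:
  "finite A \<Longrightarrow> B \<subseteq> A \<Longrightarrow> real (card A) = real (card (A - B)) + real (card B)"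
  by (simp add: card_Diff_subset finite_subset card_mono of_nat_diff)

text \<open>The constant is 3072 = 12 * 256: with the mean bound 256 / n^3, Markov's inequality then
  discards at most 8^n / (12 n^2) walks, half of those that are guaranteed to exist.\<close>

definition low_energy_steps :: "nat \<Rightarrow> (int ^ 4) list set" where
  "low_energy_steps n = {s \<in> closed_steps n. energy (loop_at 0 s) \<le> 3072 * (1 + ln (real n + 1)) / real n}"

text \<open>Two points at sup-distance above 2r never lie in a common ball of radius r, so this
  width forces a loop out of the ball wherever it is placed.\<close>

definition wide_steps :: "nat \<Rightarrow> nat \<Rightarrow> (int ^ 4) list set" where
  "wide_steps r n = {s \<in> closed_steps n. \<exists>i<n. linf_norm (part s i) > int (2 * r)}"

lemma card_closed_steps_ge:
  assumes "even n" "n \<ge> 2"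
  shows "real (card (closed_steps n)) \<ge> 8 ^ n * (1 / (6 * (real n)\<^sup>2))"
proof -
  obtain m where m: "n = 2 * m" "m \<ge> 1" using assms by (auto elim!: evenE)
  show ?thesis unfolding card_closed_steps
    using heat_return_ge[OF m(2)] m(1) by (intro mult_left_mono) auto
qed

lemma card_low_energy_steps:
  assumes "even n" "n \<ge> 2"
  shows "real (card (low_energy_steps n)) \<ge> 8 ^ n * (1 / (12 * (real n)\<^sup>2))"
proof -
  let ?L = "1 + ln (real n + 1)"
  define B where "B = closed_steps n - low_energy_steps n"
  have L: "?L > 0" using ln_ge_zero[of "real n + 1"] by linarith
  have en: "energy (loop_at 0 s) \<ge> 0" for s
    using energy_pos[of "loop_at 0 s"] by (cases "loop_at 0 s = []") (auto simp: energy_def)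
  have "real (card B) * (3072 * ?L / real n) = (\<Sum>s\<in>B. 3072 * ?L / real n)" by simp
  also have "\<dots> \<le> (\<Sum>s\<in>B. energy (loop_at 0 s))"
    by (rule sum_mono) (auto simp: B_def low_energy_steps_def)
  also have "\<dots> \<le> (\<Sum>s\<in>closed_steps n. energy (loop_at 0 s))"
    by (rule sum_mono2) (auto simp: B_def finite_closed_steps en)
  also have "\<dots> \<le> 8 ^ n * (256 / (real n) ^ 3 * ?L)"
    by (rule sum_closed_steps_energy_le) (use assms in simp)
  also have "\<dots> = (8 ^ n * (1 / (12 * (real n)\<^sup>2))) * (3072 * ?L / real n)"
    using assms by (simp add: field_simps power2_eq_square power3_eq_cube)
  finally have "real (card B) \<le> 8 ^ n * (1 / (12 * (real n)\<^sup>2))"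
    by (rule mult_right_le_imp_le) (use L assms in simp)
  moreover have "real (card (closed_steps n)) = real (card B) + real (card (low_energy_steps n))"
    unfolding B_def by (rule real_card_Diff[OF finite_closed_steps]) (auto simp: low_energy_steps_def)
  moreover have "8 ^ n * (1 / (6 * (real n)\<^sup>2)) = 2 * (8 ^ n * (1 / (12 * (real n)\<^sup>2)))" by simp
  ultimately show ?thesis using card_closed_steps_ge[OF assms] by linarith
qed

text \<open>A walk that is not wide has its midpoint in a box of (4r + 1)^4 points, and for each
  such point the two halves admit at most 8^n (16 / n^2)^2 closed walks. The assumption on
  \<open>n\<close> makes this small enough since 56^2 = 3136 exceeds 12 * 256.\<close>

lemma card_wide_steps:
  assumes "even n" "n \<ge> 2" "n \<ge> 56 * (4 * r + 1)\<^sup>2"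
  shows "real (card (wide_steps r n)) \<ge> 8 ^ n * (1 / (12 * (real n)\<^sup>2))"
proof -
  obtain m where m: "n = 2 * m" "m \<ge> 1" using assms by (auto elim!: evenE)
  define Z where "Z = {z :: int ^ 4. linf_norm z \<le> int (2 * r)}"
  have Z: "finite Z" "card Z \<le> (4 * r + 1) ^ 4"
    using linf_norm_box[of "2 * r"] by (auto simp: Z_def)
  define B where "B = closed_steps n - wide_steps r n"
  have "B \<subseteq> (\<Union>z\<in>Z. {s \<in> steps n. sum_list s = 0 \<and> part s m = z})"
  proof
    fix s assume "s \<in> B"
    then have "s \<in> closed_steps n" "\<forall>i<n. linf_norm (part s i) \<le> int (2 * r)"
      by (auto simp: B_def wide_steps_def)
    moreover have "m < n" using m by simp
    ultimately show "s \<in> (\<Union>z\<in>Z. {s \<in> steps n. sum_list s = 0 \<and> part s m = z})"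
      by (auto simp: Z_def closed_steps_def)
  qed
  then have "card B \<le> card (\<Union>z\<in>Z. {s \<in> steps n. sum_list s = 0 \<and> part s m = z})"
    by (rule card_mono[rotated]) (auto simp: Z finite_steps)
  also have "\<dots> \<le> (\<Sum>z\<in>Z. card {s \<in> steps n. sum_list s = 0 \<and> part s m = z})"
    by (rule card_UN_le[OF Z(1)])
  finally have "real (card B) \<le> (\<Sum>z\<in>Z. real (card {s \<in> steps n. sum_list s = 0 \<and> part s m = z}))"
    by (simp flip: of_nat_sum)
  also have "\<dots> = (\<Sum>z\<in>Z. 8 ^ n * (heat m z * heat m z))"
    using card_steps_split[of m n 0] m by (simp add: heat_minus)
  also have "\<dots> \<le> (\<Sum>z\<in>Z. 8 ^ n * (16 / (real n)\<^sup>2 * (16 / (real n)\<^sup>2)))"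
  proof (intro sum_mono mult_left_mono mult_mono heat_nonneg)
    fix z
    have "4 / (real m + 1)\<^sup>2 \<le> 4 / (real m)\<^sup>2"
      using m by (intro divide_left_mono power_mono) auto
    then show "heat m z \<le> 16 / (real n)\<^sup>2" "heat m z \<le> 16 / (real n)\<^sup>2"
      using heat_le_sq[of m z] m by (simp_all add: power_mult_distrib)
  qed auto
  also have "\<dots> = 8 ^ n * (real (card Z) * 256 / (real n) ^ 4)"
    by (simp add: power4_eq_xxxx power2_eq_square mult_ac)
  also have "\<dots> \<le> 8 ^ n * (1 / (12 * (real n)\<^sup>2))"
  proof (rule mult_left_mono)
    have "real (card Z) * 3072 \<le> real ((4 * r + 1) ^ 4) * 3136" 
      using Z(2) by (intro mult_mono of_nat_mono) auto
    also have "\<dots> = (real (56 * (4 * r + 1)\<^sup>2))\<^sup>2"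
      by (simp add: power_mult_distrib flip: power_mult)
    also have "\<dots> \<le> (real n)\<^sup>2"
      using assms(3) by (intro power_mono of_nat_mono) auto
    finally have "real (card Z) * 3072 \<le> (real n)\<^sup>2" .
    then show "real (card Z) * 256 / (real n) ^ 4 \<le> 1 / (12 * (real n)\<^sup>2)"
      using assms by (simp add: divide_simps power4_eq_xxxx power2_eq_square)
  qed simp
  finally have "real (card B) \<le> 8 ^ n * (1 / (12 * (real n)\<^sup>2))" .
  moreover have "real (card (closed_steps n)) = real (card B) + real (card (wide_steps r n))"
    unfolding B_def by (rule real_card_Diff[OF finite_closed_steps]) (auto simp: wide_steps_def)
  moreover have "8 ^ n * (1 / (6 * (real n)\<^sup>2)) = 2 * (8 ^ n * (1 / (12 * (real n)\<^sup>2)))" by simp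
  ultimately show ?thesis using card_closed_steps_ge[OF assms(1,2)] by linarith
qed

text \<open>The linearised second moment inequality $1 \geq 2 c N - c^2 N^2$ is used on every fibre, so that it can be
  summed over paths before $c$ is optimised.\<close>

lemma card_image_ge_second_moment:
  fixes c :: real
  assumes A: "finite A"
  shows "real (card (f ` A)) \<ge> 2 * c * real (card A) - c\<^sup>2 * (\<Sum>a\<in>A. \<Sum>b\<in>A. of_bool (f a = f b))"
proof -
  define N where "N y = real (card {a \<in> A. f a = y})" for y
  have "real (card A) = (\<Sum>a\<in>A. 1)" by simp
  also have "\<dots> = (\<Sum>y\<in>f ` A. \<Sum>a\<in>{a \<in> A. f a = y}. 1)"
    by (rule sum.group[symmetric]) (auto simp: A)
  finally have 1: "real (card A) = (\<Sum>y\<in>f ` A. N y)" by (simp add: N_def)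
  have "(\<Sum>b\<in>A. of_bool (f a = f b)) = N (f a)" for a
    using sum.inter_filter[OF A, of "\<lambda>_. 1 :: real" "\<lambda>b. f b = f a"] by (simp add: N_def of_bool_def eq_commute)
  then have "(\<Sum>a\<in>A. \<Sum>b\<in>A. of_bool (f a = f b)) = (\<Sum>a\<in>A. N (f a))" by simp
  also have "\<dots> = (\<Sum>y\<in>f ` A. \<Sum>a\<in>{a \<in> A. f a = y}. N (f a))"
    by (rule sum.group[symmetric]) (auto simp: A)
  also have "\<dots> = (\<Sum>y\<in>f ` A. N y * N y)"
    by (intro sum.cong refl) (simp add: N_def)
  finally have 2: "(\<Sum>a\<in>A. \<Sum>b\<in>A. of_bool (f a = f b)) = (\<Sum>y\<in>f ` A. N y * N y)" .
  have "2 * c * real (card A) - c\<^sup>2 * (\<Sum>a\<in>A. \<Sum>b\<in>A. of_bool (f a = f b))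
      = (\<Sum>y\<in>f ` A. 2 * c * N y - c\<^sup>2 * (N y * N y))"
    unfolding 1 2 by (simp add: sum_distrib_left sum_subtractf)
  also have "\<dots> \<le> (\<Sum>y\<in>f ` A. 1)"
  proof (rule sum_mono)
    fix y
    have "(c * N y - 1)\<^sup>2 \<ge> 0" by simp
    then show "2 * c * N y - c\<^sup>2 * (N y * N y) \<le> 1" by (simp add: power2_eq_square algebra_simps)
  qed
  finally show ?thesis by simp
qed

text \<open>The base points for which the loop with steps \<open>s\<close> meets \<open>xs\<close>:
  the entry that is met and the time at which it is met determine the base point. Different pairs
  may give the same point, which is what the second moment has to control.\<close>

definition hits :: "(int ^ 4) list \<Rightarrow> (int ^ 4) list \<Rightarrow> (int ^ 4) set" where
  "hits xs s = (\<lambda>(i, j). xs ! i - part s j) ` ({..<length xs} \<times> {..<length s})"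

text \<open>Two pairs give the same base point when an increment of the loop equals a difference of
  entries of \<open>xs\<close>; averaging over loops produces the energy of \<open>xs\<close>. The
  second moment is taken over all closed walks, so the family \<open>Q\<close> enters through its
  size alone and low-energy and wide loops are treated at once.\<close>

lemma sum_card_hits_ge:
  assumes n: "n \<ge> 1" and xs: "xs \<noteq> []" and Q: "Q \<subseteq> closed_steps n"
    and card_Q: "real (card Q) \<ge> 8 ^ n * (1 / (12 * (real n)\<^sup>2))"
  shows "(\<Sum>s\<in>Q. real (card (hits xs s))) \<ge> 8 ^ n * (1 / (9216 * real n * energy xs))"
proof -
  let ?l = "length xs"
  define E where "E = energy xs"
  have E: "E > 0" using energy_pos[OF xs] by (simp add: E_def)
  have l: "real ?l > 0" using xs by simp
  have finQ: "finite Q" using Q finite_closed_steps finite_subset by blast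
  \<comment> \<open>The optimal value: the first moment 8^n l / (12 n) divided by the second moment
    bound 8^n * 64 l^2 E / n. The resulting constant is 12^2 * 64 = 9216.\<close>
  define c where "c = 1 / (768 * E * real ?l)"
  have c: "c \<ge> 0" using E by (simp add: c_def)
  define S where "S s = (\<Sum>a\<in>{..<?l} \<times> {..<n}. \<Sum>b\<in>{..<?l} \<times> {..<n}.
      of_bool (xs ! fst a - part s (snd a) = xs ! fst b - part s (snd b)) :: real)" for s
  have len: "length s = n" if "s \<in> closed_steps n" for s using that by (simp add: closed_steps_def steps_def)
  have "(\<Sum>s\<in>closed_steps n. S s) \<le> 8 ^ n * (64 / real n * ((real ?l)\<^sup>2 * E))"
  proof -
    have "(\<Sum>s\<in>closed_steps n. S s) = (\<Sum>s\<in>closed_steps n. \<Sum>i<?l. \<Sum>i'<?l. \<Sum>j<n. \<Sum>j'<n.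
        of_bool (part s j - part s j' = xs ! i - xs ! i'))"
    proof (rule sum.cong[OF refl])
      fix s
      have eq: "(xs ! i - part s j = xs ! i' - part s j') = (part s j - part s j' = xs ! i - xs ! i')" for i i' j j'
        by (metis (no_types, opaque_lifting) add_diff_cancel_left' diff_add_cancel diff_diff_eq2 diff_eq_eq)
      have "S s = (\<Sum>i<?l. \<Sum>j<n. \<Sum>i'<?l. \<Sum>j'<n. of_bool (part s j - part s j' = xs ! i - xs ! i'))"
        unfolding S_def by (simp add: sum.cartesian_product' eq)
      also have "\<dots> = (\<Sum>i<?l. \<Sum>i'<?l. \<Sum>j<n. \<Sum>j'<n. of_bool (part s j - part s j' = xs ! i - xs ! i'))"
        by (intro sum.cong refl sum.swap)
      finally show "S s = (\<Sum>i<?l. \<Sum>i'<?l. \<Sum>j<n. \<Sum>j'<n. of_bool (part s j - part s j' = xs ! i - xs ! i'))" .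
    qed
    also have "\<dots> = (\<Sum>i<?l. \<Sum>i'<?l. \<Sum>s\<in>closed_steps n. \<Sum>j<n. \<Sum>j'<n.
        of_bool (part s j - part s j' = xs ! i - xs ! i'))"
      by (rule sum_swap3[symmetric])
    also have "\<dots> = (\<Sum>i<?l. \<Sum>i'<?l. \<Sum>j<n. \<Sum>j'<n. \<Sum>s\<in>closed_steps n.
        of_bool (part s j - part s j' = xs ! i - xs ! i'))"
      by (intro sum.cong refl sum_swap3[symmetric])
    also have "\<dots> = (\<Sum>i<?l. \<Sum>i'<?l. \<Sum>j<n. \<Sum>j'<n. real (card {s \<in> closed_steps n. part s j - part s j' = xs ! i - xs ! i'}))"
      using sum.inter_filter[OF finite_closed_steps[of n], of "\<lambda>_. 1 :: real"] by (simp add: of_bool_def)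
    also have "\<dots> \<le> (\<Sum>i<?l. \<Sum>i'<?l. 8 ^ n * (64 / real n * green (xs ! i - xs ! i')))"
    proof (intro sum_mono)
      fix i i'
      show "(\<Sum>j<n. \<Sum>j'<n. real (card {s \<in> closed_steps n. part s j - part s j' = xs ! i - xs ! i'}))
          \<le> 8 ^ n * (64 / real n * green (xs ! i - xs ! i'))"
        by (rule order_trans[OF sum_closed_steps_increment_le[OF n]])
          (intro mult_left_mono sum_heat_le_green, auto)
    qed
    also have "\<dots> = 8 ^ n * (64 / real n * ((real ?l)\<^sup>2 * E))"
    proof -
      have "(real ?l)\<^sup>2 * E = (\<Sum>i<?l. \<Sum>i'<?l. green (xs ! i - xs ! i'))"
        using l by (simp add: E_def energy_def)
      then show ?thesis by (simp only: sum_distrib_left)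
    qed
    finally show ?thesis .
  qed
  moreover have "(\<Sum>s\<in>Q. S s) \<le> (\<Sum>s\<in>closed_steps n. S s)"
    by (rule sum_mono2[OF finite_closed_steps Q]) (auto simp: S_def intro!: sum_nonneg)
  ultimately have SQ: "(\<Sum>s\<in>Q. S s) \<le> 8 ^ n * (64 / real n * ((real ?l)\<^sup>2 * E))" by linarith
  have "real (card (hits xs s)) \<ge> 2 * c * (real ?l * real n) - c\<^sup>2 * S s" if s: "s \<in> Q" for s
    using card_image_ge_second_moment[of "{..<?l} \<times> {..<n}" c "\<lambda>(i, j). xs ! i - part s j"] len[of s] s Q
    by (auto simp: hits_def S_def case_prod_unfold)
  then have "(\<Sum>s\<in>Q. real (card (hits xs s))) \<ge> (\<Sum>s\<in>Q. 2 * c * (real ?l * real n) - c\<^sup>2 * S s)"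
    by (rule sum_mono)
  also have "(\<Sum>s\<in>Q. 2 * c * (real ?l * real n) - c\<^sup>2 * S s)
      = real (card Q) * (2 * c * (real ?l * real n)) - c\<^sup>2 * (\<Sum>s\<in>Q. S s)"
    by (simp add: sum_subtractf sum_distrib_left)
  finally have "(\<Sum>s\<in>Q. real (card (hits xs s))) \<ge> real (card Q) * (2 * c * (real ?l * real n)) - c\<^sup>2 * (\<Sum>s\<in>Q. S s)" .
  moreover have "real (card Q) * (2 * c * (real ?l * real n)) \<ge> 8 ^ n * (1 / (12 * (real n)\<^sup>2)) * (2 * c * (real ?l * real n))"
    by (rule mult_right_mono[OF card_Q]) (use c in simp)
  moreover have "c\<^sup>2 * (\<Sum>s\<in>Q. S s) \<le> c\<^sup>2 * (8 ^ n * (64 / real n * ((real ?l)\<^sup>2 * E)))"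
    by (rule mult_left_mono[OF SQ]) simp
  moreover have "8 ^ n * (1 / (12 * (real n)\<^sup>2)) * (2 * c * (real ?l * real n)) = 8 ^ n * (1 / (4608 * real n * E))"
    using l n E by (simp add: c_def power2_eq_square)
  moreover have "c\<^sup>2 * (8 ^ n * (64 / real n * ((real ?l)\<^sup>2 * E))) = 8 ^ n * (1 / (9216 * real n * E))"
    using l n E by (simp add: c_def power2_eq_square)
  moreover have "8 ^ n * (1 / (4608 * real n * E)) = 2 * (8 ^ n * (1 / (9216 * real n * E)))" by simp
  ultimately show ?thesis unfolding E_def by linarith
qed

text \<open>Closed walks have even length. The upper end 4 * 4^k lies below the next window, which
  starts at 8 * 4^k, so different scales share no loops.\<close>

definition scale_lengths :: "nat \<Rightarrow> nat set" where
  "scale_lengths k = {n. even n \<and> 2 * 4 ^ k \<le> n \<and> n < 4 * 4 ^ k}"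

definition scale_loops :: "nat \<Rightarrow> (nat \<Rightarrow> (int ^ 4) list set) \<Rightarrow> (int ^ 4) list \<Rightarrow> (int ^ 4) list set" where
  "scale_loops k Q xs = (\<lambda>(s, x). loop_at x s) ` (SIGMA s:(\<Union>n\<in>scale_lengths k. Q n). hits xs s)"

lemma scale_lengths_eq: "scale_lengths k = (*) 2 ` {4 ^ k..<2 * 4 ^ k}"
  unfolding scale_lengths_def by (auto elim!: evenE)

lemma finite_scale_lengths: "finite (scale_lengths k)"
  by (simp add: scale_lengths_eq)

lemma finite_hits: "finite (hits xs s)"
  by (simp add: hits_def)

lemma nth_closed_steps:
  assumes "s \<in> closed_steps n" "i < n"
  shows "part s (Suc i mod n) - part s i = s ! i"
proof -
  have l: "length s = n" "sum_list s = 0" using assms by (auto simp: closed_steps_def steps_def)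
  have "part s (Suc i) = part s i + s ! i"
    using assms l by (simp add: part_def take_Suc_conv_app_nth)
  moreover have "part s (Suc i mod n) = part s (Suc i)"
  proof (cases "Suc i = n")
    case True
    then show ?thesis using l by (simp add: part_def)
  next
    case False
    then show ?thesis using assms by simp
  qed
  ultimately show ?thesis by simp
qed

text \<open>A based loop determines its base point and its steps, so a sum over pairs (s, x) counts
  every based loop once.\<close>

lemma inj_on_loop_at:
  "inj_on (\<lambda>(s, x). loop_at x s) ((\<Union>n\<in>{1..}. closed_steps n) \<times> UNIV)"
proof (rule inj_on_inverseI[where g = "\<lambda>ys. (map (\<lambda>i. ys ! (Suc i mod length ys) - ys ! i) [0..<length ys], ys ! 0)"])
  fix p assume "p \<in> (\<Union>n\<in>{1..}. closed_steps n) \<times> (UNIV :: (int ^ 4) set)"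
  then obtain s x n where p: "p = (s, x)" "s \<in> closed_steps n" "n \<ge> 1" by auto
  then have l: "length s = n" by (auto simp: closed_steps_def steps_def)
  have "map (\<lambda>i. loop_at x s ! (Suc i mod n) - loop_at x s ! i) [0..<n] = s"
    using l p nth_closed_steps[OF p(2)] by (intro nth_equalityI) (auto simp: algebra_simps)
  moreover have "loop_at x s ! 0 = x" using l p by (simp add: part_def)
  ultimately show "(map (\<lambda>i. (case p of (s, x) \<Rightarrow> loop_at x s) ! (Suc i mod length (case p of (s, x) \<Rightarrow> loop_at x s)) -
      (case p of (s, x) \<Rightarrow> loop_at x s) ! i) [0..<length (case p of (s, x) \<Rightarrow> loop_at x s)],
      (case p of (s, x) \<Rightarrow> loop_at x s) ! 0) = p"
    using p l by simp
qed

lemma zadj_neq: "zadj x y \<Longrightarrow> x \<noteq> y"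
  by (auto simp: zadj_def)

lemma zadj_loop_at:
  assumes "s \<in> closed_steps n" "i < n"
  shows "zadj (loop_at x s ! i) (loop_at x s ! (Suc i mod n))"
proof -
  have l: "length s = n" using assms by (auto simp: closed_steps_def steps_def)
  have "s ! i \<in> unit_steps"
    using assms by (auto simp: closed_steps_def steps_def)
  then have "zadj 0 (part s (Suc i mod n) - part s i)"
    using nth_closed_steps[OF assms] by (simp add: unit_steps_def)
  then show ?thesis using l assms by (simp add: zadj_def abs_minus_commute)
qed

lemma based_loop_loop_at:
  assumes "s \<in> closed_steps n" "n \<ge> 2"
  shows "loop_at x s \<in> based_loops" "based_loop_weight (loop_at x s) = 1 / (real n * 8 ^ n)"
proof -
  have l: "length s = n" using assms by (auto simp: closed_steps_def steps_def)
  show "loop_at x s \<in> based_loops"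
    unfolding based_loops_def using zadj_neq[OF zadj_loop_at[OF assms(1)]] l assms(2) by simp
  have "(\<Prod>i<n. srw_kernel (loop_at x s ! i) (loop_at x s ! (Suc i mod n))) = (\<Prod>i<n. 1 / 8)"
    by (rule prod.cong) (use zadj_loop_at[OF assms(1)] in \<open>auto simp: srw_kernel_def\<close>)
  then show "based_loop_weight (loop_at x s) = 1 / (real n * 8 ^ n)"
    using l by (simp add: based_loop_weight_def power_one_over)
qed

lemma scale_lengths_ge_2: "n \<in> scale_lengths k \<Longrightarrow> n \<ge> 2"
proof -
  assume "n \<in> scale_lengths k"
  then have "2 * 4 ^ k \<le> n" by (simp add: scale_lengths_def)
  moreover have "(1::nat) \<le> 4 ^ k" by simp
  ultimately show "n \<ge> 2" by linarith
qed

lemma finite_scale_loops: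
  assumes "\<And>n. n \<in> scale_lengths k \<Longrightarrow> Q n \<subseteq> closed_steps n"
  shows "finite (scale_loops k Q xs)"
  unfolding scale_loops_def
  by (intro finite_imageI finite_SigmaI finite_UN_I finite_scale_lengths finite_hits)
    (use assms finite_closed_steps finite_subset in blast)

text \<open>The weight 1 / (n 8^n) leaves 1 / (9216 n^2 E) for each length n. There are 4^k lengths,
  all below 4 * 4^k, and 147456 = 9216 * 16.\<close>

lemma weight_scale_loops_ge:
  assumes xs: "xs \<noteq> []" and Q: "\<And>n. n \<in> scale_lengths k \<Longrightarrow> Q n \<subseteq> closed_steps n"
    and card_Q: "\<And>n. n \<in> scale_lengths k \<Longrightarrow> real (card (Q n)) \<ge> 8 ^ n * (1 / (12 * (real n)\<^sup>2))"
  shows "(\<Sum>ys\<in>scale_loops k Q xs. based_loop_weight ys) \<ge> 1 / (147456 * 4 ^ k * energy xs)"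
proof -
  have fin: "finite (Q n)" if "n \<in> scale_lengths k" for n
    using Q[OF that] finite_closed_steps finite_subset by blast
  have disj: "Q m \<inter> Q n = {}" if "m \<in> scale_lengths k" "n \<in> scale_lengths k" "m \<noteq> n" for m n
    using Q[OF that(1)] Q[OF that(2)] that(3) by (auto simp: closed_steps_def steps_def)
  have inj: "inj_on (\<lambda>(s, x). loop_at x s) (SIGMA s:(\<Union>n\<in>scale_lengths k. Q n). hits xs s)"
    by (rule inj_on_subset[OF inj_on_loop_at]) (use Q scale_lengths_ge_2 in fastforce)
  have E: "energy xs > 0" by (rule energy_pos[OF xs])
  have "1 / (147456 * 4 ^ k * energy xs) = (\<Sum>n\<in>scale_lengths k. 1 / (9216 * (4 * 4 ^ k)\<^sup>2 * energy xs))"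
  proof -
    have "card (scale_lengths k) = 4 ^ k"
      unfolding scale_lengths_eq by (subst card_image) (auto simp: inj_on_def)
    then show ?thesis by (simp add: power2_eq_square)
  qed
  also have "\<dots> \<le> (\<Sum>n\<in>scale_lengths k. 1 / (9216 * (real n)\<^sup>2 * energy xs))"
  proof (intro sum_mono divide_left_mono mult_right_mono mult_left_mono power_mono)
    fix n assume n: "n \<in> scale_lengths k"
    then have "n \<le> 4 * 4 ^ k" by (simp add: scale_lengths_def)
    from of_nat_mono[OF this, where 'a = real] show "real n \<le> 4 * 4 ^ k" by simp
    show "0 < 9216 * (4 * 4 ^ k)\<^sup>2 * energy xs * (9216 * (real n)\<^sup>2 * energy xs)"
      using E scale_lengths_ge_2[OF n] by simp
  qed (use E in auto)
  also have "\<dots> \<le> (\<Sum>n\<in>scale_lengths k. \<Sum>s\<in>Q n. \<Sum>x\<in>hits xs s. based_loop_weight (loop_at x s))"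
  proof (rule sum_mono)
    fix n assume n: "n \<in> scale_lengths k"
    have n2: "n \<ge> 2" by (rule scale_lengths_ge_2[OF n])
    have "1 / (9216 * (real n)\<^sup>2 * energy xs) = 8 ^ n * (1 / (9216 * real n * energy xs)) * (1 / (real n * 8 ^ n))"
      by (simp add: power2_eq_square)
    also have "\<dots> \<le> (\<Sum>s\<in>Q n. real (card (hits xs s))) * (1 / (real n * 8 ^ n))"
      by (intro mult_right_mono sum_card_hits_ge xs Q card_Q n) (use n2 in auto)
    also have "\<dots> = (\<Sum>s\<in>Q n. \<Sum>x\<in>hits xs s. based_loop_weight (loop_at x s))"
      unfolding sum_distrib_right
    proof (rule sum.cong[OF refl])
      fix s assume "s \<in> Q n"
      then have "based_loop_weight (loop_at x s) = 1 / (real n * 8 ^ n)" for x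
        using based_loop_loop_at(2)[of s n x] Q[OF n] n2 by auto
      then show "real (card (hits xs s)) * (1 / (real n * 8 ^ n)) = (\<Sum>x\<in>hits xs s. based_loop_weight (loop_at x s))"
        by simp
    qed
    finally show "1 / (9216 * (real n)\<^sup>2 * energy xs) \<le> (\<Sum>s\<in>Q n. \<Sum>x\<in>hits xs s. based_loop_weight (loop_at x s))" .
  qed
  also have "\<dots> = (\<Sum>s\<in>(\<Union>n\<in>scale_lengths k. Q n). \<Sum>x\<in>hits xs s. based_loop_weight (loop_at x s))"
    by (rule sum.UNION_disjoint[symmetric]) (use finite_scale_lengths fin disj in auto)
  also have "\<dots> = (\<Sum>(s, x)\<in>(SIGMA s:(\<Union>n\<in>scale_lengths k. Q n). hits xs s). based_loop_weight (loop_at x s))"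
    by (rule sum.Sigma) (use finite_scale_lengths fin finite_hits in auto)
  also have "\<dots> = (\<Sum>ys\<in>scale_loops k Q xs. based_loop_weight ys)"
    unfolding scale_loops_def by (subst sum.reindex[OF inj]) (simp add: case_prod_unfold comp_def)
  finally show ?thesis .
qed

subsection \<open>Loop soups\<close>

abbreviation loop_class :: "(int ^ 4) list \<Rightarrow> (int ^ 4) list set" where
  "loop_class ys \<equiv> circular_perm `` {ys}"

lemma loop_class_in_loops: "ys \<in> based_loops \<Longrightarrow> loop_class ys \<in> loops"
  unfolding loops_def by (rule quotientI)

lemma self_in_loop_class: "ys \<in> based_loops \<Longrightarrow> ys \<in> loop_class ys"
  unfolding circular_perm_def by (auto intro: exI[of _ 0])

lemma countable_loops: "countable (loops :: (int ^ 4) list set set)"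
proof -
  have *: "(loops :: (int ^ 4) list set set) = loop_class ` based_loops"
    by (auto simp: loops_def quotient_def)
  show ?thesis unfolding * by (intro countable_image countableI_type)
qed

lemma based_loop_weight_nonneg: "based_loop_weight ys \<ge> 0"
  unfolding based_loop_weight_def
  by (intro mult_nonneg_nonneg prod_nonneg) (auto simp: srw_kernel_def)

text \<open>Based loops of the same class all lie in the preimage of \<open>G\<close>, so each adds
  its own weight and no representatives have to be chosen.\<close>

lemma emeasure_loop_measure_ge:
  assumes "finite D" "D \<subseteq> based_loops" "G \<subseteq> loops" "loop_class ` D \<subseteq> G"
  shows "emeasure loop_measure G \<ge> ennreal (\<Sum>ys\<in>D. based_loop_weight ys)"
proof -

  have meas: "loop_class \<in> measurable based_loop_measure (count_space loops)"
    unfolding based_loop_measure_def using loop_class_in_loops by (auto simp: measurable_def space_point_measure sets_point_measure)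
  have "emeasure based_loop_measure D = (\<Sum>ys\<in>D. ennreal (based_loop_weight ys))"
    unfolding based_loop_measure_def by (rule emeasure_point_measure_finite2[OF assms(2,1)])
  then have "ennreal (\<Sum>ys\<in>D. based_loop_weight ys) = emeasure based_loop_measure D"
    by (simp add: based_loop_weight_nonneg)
  also have "\<dots> \<le> emeasure based_loop_measure (loop_class -` G \<inter> space based_loop_measure)"
  proof (rule emeasure_mono)
    have "D \<subseteq> loop_class -` G" using assms(4) by blast
    then show "D \<subseteq> loop_class -` G \<inter> space based_loop_measure"
      using assms(2) by (simp add: based_loop_measure_def space_point_measure)
  qed (auto simp: based_loop_measure_def space_point_measure sets_point_measure)
  also have "\<dots> = emeasure loop_measure G"
    unfolding loop_measure_def by (rule emeasure_distr[symmetric, OF meas]) (use assms in simp)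
  finally show ?thesis .
qed

text \<open>The events \<open>E i\<close> may be dependent. Following only the first
  \<open>i\<close> for which \<open>S i\<close> occurs makes the choice an event of the first
  family, independent of each \<open>E i\<close>; \<open>E0\<close> is the fallback when none
  occurs. The event \<open>X\<close> is there for the induction, which passes from \<open>X\<close>
  to \<open>X - D\<close>.\<close>

lemma (in prob_space) prob_union_cond_ge:
  assumes A: "sigma_algebra (space M) \<A>" "\<A> \<subseteq> events" and B: "\<B> \<subseteq> events"
    and indep: "\<And>X Y. X \<in> \<A> \<Longrightarrow> Y \<in> \<B> \<Longrightarrow> prob (X \<inter> Y) = prob X * prob Y"
    and I: "finite I" "\<And>i. i \<in> I \<Longrightarrow> S i \<in> \<A>" "\<And>i. i \<in> I \<Longrightarrow> E i \<in> \<B>" "\<And>i. i \<in> I \<Longrightarrow> prob (E i) \<ge> v"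
    and E0: "E0 \<in> \<B>" "prob E0 \<ge> v0" and X: "X \<in> \<A>"
  shows "prob (X \<inter> (E0 \<union> (\<Union>i\<in>I. S i \<inter> E i))) \<ge> v0 * prob X + (v - v0) * prob (X \<inter> (\<Union>i\<in>I. S i))"
  using I X
proof (induction I arbitrary: X rule: finite_induct)
  case empty
  have "prob (X \<inter> E0) = prob X * prob E0" by (rule indep) (use empty E0 in auto)
  also have "\<dots> \<ge> prob X * v0" by (rule mult_left_mono[OF E0(2)]) simp
  finally show ?case by (simp add: mult.commute)
next
  case (insert i I)
  interpret \<A>: sigma_algebra "space M" \<A> by (rule A)
  define U where "U = (\<Union>i\<in>I. S i)"
  define old where "old = E0 \<union> (\<Union>i\<in>I. S i \<inter> E i)"
  define D where "D = S i - U"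
  have U: "U \<in> \<A>" unfolding U_def using insert by auto
  have D: "D \<in> \<A>" unfolding D_def using insert U by auto
  have ev: "old \<in> events" unfolding old_def using insert.hyps insert.prems A(2) B E0 by (auto intro!: sets.Un sets.finite_UN sets.Int)
  have XD: "X - D \<in> \<A>" "X \<inter> D \<in> \<A>" using insert.prems D by auto
  have ei: "E i \<in> events" "E i \<in> \<B>" "prob (E i) \<ge> v" using insert B by auto
  have "prob ((X - D) \<inter> old) \<ge> v0 * prob (X - D) + (v - v0) * prob ((X - D) \<inter> U)"
    unfolding old_def U_def by (rule insert.IH) (use insert XD in auto)
  moreover have "prob ((X \<inter> D) \<inter> E i) \<ge> v * prob (X \<inter> D)"
    unfolding indep[OF XD(2) ei(2)] using ei(3) by (subst mult.commute) (rule mult_left_mono, auto)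
  moreover have "prob ((X - D) \<inter> old) + prob ((X \<inter> D) \<inter> E i) \<le> prob (X \<inter> (E0 \<union> (\<Union>i\<in>insert i I. S i \<inter> E i)))"
  proof -
    have "prob ((X - D) \<inter> old) + prob ((X \<inter> D) \<inter> E i) = prob (((X - D) \<inter> old) \<union> ((X \<inter> D) \<inter> E i))"
      by (rule finite_measure_Union[symmetric]) (use XD A(2) ev ei in auto)
    also have "\<dots> \<le> prob (X \<inter> (E0 \<union> (\<Union>i\<in>insert i I. S i \<inter> E i)))"
    proof (rule finite_measure_mono)
      show "((X - D) \<inter> old) \<union> ((X \<inter> D) \<inter> E i) \<subseteq> X \<inter> (E0 \<union> (\<Union>i\<in>insert i I. S i \<inter> E i))"
        by (auto simp: old_def D_def)
      have "X \<inter> (E0 \<union> (\<Union>i\<in>insert i I. S i \<inter> E i)) = (X \<inter> old) \<union> (X \<inter> (S i \<inter> E i))"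
        by (auto simp: old_def)
      also have "\<dots> \<in> events"
      proof -
        have "X \<in> events" "S i \<in> events" using insert.prems A(2) by blast+
        then show ?thesis using ev ei by auto
      qed
      finally show "X \<inter> (E0 \<union> (\<Union>i\<in>insert i I. S i \<inter> E i)) \<in> events" .
    qed
    finally show ?thesis .
  qed
  moreover have "prob X = prob (X - D) + prob (X \<inter> D)"
  proof -
    have "prob X = prob ((X - D) \<union> (X \<inter> D))" by (rule arg_cong[of _ _ prob]) auto
    also have "\<dots> = prob (X - D) + prob (X \<inter> D)"
      by (rule finite_measure_Union) (use XD A(2) in auto)
    finally show ?thesis .
  qed
  moreover have "prob (X \<inter> (\<Union>i\<in>insert i I. S i)) = prob ((X - D) \<inter> U) + prob (X \<inter> D)"
  proof -
    have "prob (X \<inter> (\<Union>i\<in>insert i I. S i)) = prob (((X - D) \<inter> U) \<union> (X \<inter> D))"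
      by (rule arg_cong[of _ _ prob]) (auto simp: U_def D_def)
    also have "\<dots> = prob ((X - D) \<inter> U) + prob (X \<inter> D)"
      by (rule finite_measure_Union) (use XD A(2) U in auto)
    finally show ?thesis .
  qed
  ultimately show ?case by (simp add: algebra_simps)
qed

section \<open>Occupation and independence in the Poisson process of loops\<close>

locale loop_soup_process =
  fixes \<alpha> :: real and M :: "'w measure" and N :: "'w \<Rightarrow> (int ^ 4) list set measure"
  assumes soup: "loop_soup \<alpha> M N" and \<alpha>_pos: "\<alpha> > 0"
begin

sublocale prob_space M
  using soup by (simp add: loop_soup_def poisson_point_process_def)

lemma sets_loop_measure [simp]: "sets loop_measure = Pow loops"
  by (simp add: loop_measure_def)

lemma sets_N: "\<omega> \<in> space M \<Longrightarrow> sets (N \<omega>) = Pow loops"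
  using soup by (simp add: loop_soup_def poisson_point_process_def)

lemma measurable_N: "A \<subseteq> loops \<Longrightarrow> (\<lambda>\<omega>. emeasure (N \<omega>) A) \<in> borel_measurable M"
  using soup by (simp add: loop_soup_def poisson_point_process_def)

definition occupied :: "(int ^ 4) list set set \<Rightarrow> 'w set" where
  "occupied A = {\<omega> \<in> space M. emeasure (N \<omega>) A \<noteq> 0}"

lemma occupied_events: "A \<subseteq> loops \<Longrightarrow> occupied A \<in> events"
  unfolding occupied_def using measurable_N[of A] by measurable

lemma prob_occupied_ge:
  assumes G: "G \<subseteq> loops" and a: "emeasure loop_measure G \<ge> ennreal a" and "a \<ge> 0"
  shows "prob (occupied G) \<ge> 1 - exp (- (\<alpha> * a))"
proof -
  let ?\<nu> = "scale_measure (ennreal \<alpha>) loop_measure"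
  have \<nu>: "emeasure ?\<nu> G \<ge> ennreal (\<alpha> * a)"
    using mult_left_mono[OF a, of "ennreal \<alpha>"] \<alpha>_pos assms(3) by (simp add: ennreal_mult)
  show ?thesis
  proof (cases "emeasure ?\<nu> G = \<infinity>")
    case True
    then have "AE \<omega> in M. emeasure (N \<omega>) G = \<infinity>"
      using soup G unfolding loop_soup_def poisson_point_process_def by simp
    then have "AE \<omega> in M. \<omega> \<in> occupied G"
      by (rule AE_mp) (rule AE_I2, auto simp: occupied_def)
    then have "prob (occupied G) = 1"
      using prob_eq_1[OF occupied_events[OF G]] by simp
    then show ?thesis by simp
  next
    case False
    then have fin: "emeasure ?\<nu> G < \<infinity>" by (simp add: top.not_eq_extremum)
    have "\<forall>k::nat. prob {\<omega> \<in> space M. emeasure (N \<omega>) G = of_nat k} = exp (- measure ?\<nu> G) * measure ?\<nu> G ^ k / fact k"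
      using soup G fin unfolding loop_soup_def poisson_point_process_def by simp
    from this[rule_format, of 0]
    have p0: "prob {\<omega> \<in> space M. emeasure (N \<omega>) G = 0} = exp (- measure ?\<nu> G)" by simp
    have "{\<omega> \<in> space M. emeasure (N \<omega>) G = 0} = space M - occupied G"
      by (auto simp: occupied_def)
    then have "1 - prob (occupied G) = exp (- measure ?\<nu> G)"
      using p0 prob_compl[OF occupied_events[OF G]] by simp
    moreover have "measure ?\<nu> G \<ge> \<alpha> * a"
    proof -
      have "emeasure ?\<nu> G = ennreal (measure ?\<nu> G)"
        by (rule emeasure_eq_ennreal_measure) (use False in simp)
      then show ?thesis using \<nu> by (simp only: ennreal_le_iff[OF measure_nonneg])
    qed
    ultimately show ?thesis by (smt (verit) exp_le_cancel_iff)
  qed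
qed

text \<open>Occupation of single loops suffices as generator, since arms do not depend on how often
  a loop occurs.\<close>

definition past :: "(int ^ 4) list set set \<Rightarrow> 'w set set" where
  "past J = sigma_sets (space M) ((\<lambda>l. occupied {l}) ` J)"

lemma sigma_algebra_past: "J \<subseteq> loops \<Longrightarrow> sigma_algebra (space M) (past J)"
  unfolding past_def by (rule sigma_algebra_sigma_sets) (auto simp: occupied_def)

lemma past_events: "J \<subseteq> loops \<Longrightarrow> past J \<subseteq> events"
  unfolding past_def by (rule sets.sigma_sets_subset) (auto intro!: occupied_events)

lemma past_mono: "J \<subseteq> K \<Longrightarrow> past J \<subseteq> past K"
  unfolding past_def by (intro sigma_sets_subseteq image_mono)

lemma occupied_past: "l \<in> J \<Longrightarrow> occupied {l} \<in> past J"
  unfolding past_def by (intro sigma_sets.Basic imageI)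

text \<open>The process offers independence along sequences of disjoint sets. An enumeration of the
  countably many loops yields a sequence of singletons, and disjoint blocks of its indices generate
  independent sigma-algebras.\<close>

lemma indep_past:
  assumes J: "J \<subseteq> loops" "K \<subseteq> loops" "J \<inter> K = {}" and X: "X \<in> past J" and Y: "Y \<in> past K"
  shows "prob (X \<inter> Y) = prob X * prob Y"
proof -
  define idx where "idx = (to_nat_on loops :: (int ^ 4) list set \<Rightarrow> nat)"
  define A where "A i = {l \<in> loops. idx l = i}" for i
  have inj: "inj_on idx loops" unfolding idx_def by (rule inj_on_to_nat_on[OF countable_loops])
  have A1: "A (idx l) = {l}" if "l \<in> loops" for l
    using that inj by (auto simp: A_def inj_on_def)
  have "range A \<subseteq> sets (scale_measure (ennreal \<alpha>) loop_measure)" "disjoint_family A"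
    by (auto simp: A_def disjoint_family_on_def)
  then have "indep_vars (\<lambda>_. borel) (\<lambda>i \<omega>. emeasure (N \<omega>) (A i)) UNIV"
    using soup unfolding loop_soup_def poisson_point_process_def by blast
  then have ind: "indep_sets (\<lambda>i. {(\<lambda>\<omega>. emeasure (N \<omega>) (A i)) -` B \<inter> space M |B. B \<in> sets borel}) UNIV"
    (is "indep_sets ?E UNIV") by (simp add: indep_vars_def2)
  define I where "I b = (if b then idx ` J else idx ` K)" for b
  have collected: "indep_sets (\<lambda>j. sigma_sets (space M) (\<Union>i\<in>I j. ?E i)) UNIV"
  proof (rule indep_sets_collect_sigma)
    show "indep_sets ?E (\<Union>j\<in>UNIV. I j)" using indep_sets_mono_index[OF _ ind] by auto
    show "disjoint_family_on I UNIV"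
      using inj_on_image_Int[OF inj J(1,2)] J(3) by (auto simp: disjoint_family_on_def I_def)
    fix i
    show "Int_stable (?E i)"
      unfolding Int_stable_def
    proof safe
      fix B C :: "ennreal set" assume "B \<in> sets borel" "C \<in> sets borel"
      then show "\<exists>D. (\<lambda>\<omega>. emeasure (N \<omega>) (A i)) -` B \<inter> space M \<inter> ((\<lambda>\<omega>. emeasure (N \<omega>) (A i)) -` C \<inter> space M) =
          (\<lambda>\<omega>. emeasure (N \<omega>) (A i)) -` D \<inter> space M \<and> D \<in> sets borel"
        by (intro exI[of _ "B \<inter> C"]) auto
    qed
  qed
  have sub: "past L \<subseteq> sigma_sets (space M) (\<Union>i\<in>idx ` L. ?E i)" if "L \<subseteq> loops" for L
    unfolding past_def
  proof (rule sigma_sets_subseteq, safe)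
    fix l assume l: "l \<in> L"
    have "occupied {l} = (\<lambda>\<omega>. emeasure (N \<omega>) (A (idx l))) -` (- {0}) \<inter> space M"
      using l that A1[of l] by (auto simp: occupied_def)
    then have "occupied {l} \<in> ?E (idx l)" by (intro CollectI exI[of _ "- {0}"] conjI) auto
    then show "occupied {l} \<in> (\<Union>i\<in>idx ` L. ?E i)" using l by blast
  qed
  have "(if b then X else Y) \<in> sigma_sets (space M) (\<Union>i\<in>I b. ?E i)" for b
    unfolding I_def using subsetD[OF sub[OF J(1)] X] subsetD[OF sub[OF J(2)] Y] by (cases b) (simp_all only: if_True if_False)
  then have "prob (\<Inter>b\<in>UNIV. if b then X else Y) = (\<Prod>b\<in>UNIV. prob (if b then X else Y))"
    by (intro indep_setsD[OF collected]) simp_all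
  then show ?thesis by (simp add: UNIV_bool Int_commute)
qed

lemma prob_some_loop_occupied_ge:
  assumes "finite D" "D \<subseteq> based_loops"
  shows "prob (\<Union>ys\<in>D. occupied {loop_class ys}) \<ge> 1 - exp (- (\<alpha> * (\<Sum>ys\<in>D. based_loop_weight ys)))"
proof -
  have G: "loop_class ` D \<subseteq> loops" using assms loop_class_in_loops by auto
  have "1 - exp (- (\<alpha> * (\<Sum>ys\<in>D. based_loop_weight ys))) \<le> prob (occupied (loop_class ` D))"
  proof (rule prob_occupied_ge[OF G emeasure_loop_measure_ge[OF assms G]])
    show "(\<Sum>ys\<in>D. based_loop_weight ys) \<ge> 0"
      by (rule sum_nonneg) (rule based_loop_weight_nonneg)
  qed simp
  also have "\<dots> \<le> prob (\<Union>ys\<in>D. occupied {loop_class ys})"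
  proof (rule finite_measure_mono)
    show "occupied (loop_class ` D) \<subseteq> (\<Union>ys\<in>D. occupied {loop_class ys})"
    proof
      fix \<omega> assume \<omega>: "\<omega> \<in> occupied (loop_class ` D)"
      have "\<exists>ys\<in>D. emeasure (N \<omega>) {loop_class ys} \<noteq> 0"
      proof (rule ccontr)
        assume "\<not> (\<exists>ys\<in>D. emeasure (N \<omega>) {loop_class ys} \<noteq> 0)"
        moreover have "emeasure (N \<omega>) (\<Union>ys\<in>D. {loop_class ys}) \<le> (\<Sum>ys\<in>D. emeasure (N \<omega>) {loop_class ys})"
          by (rule emeasure_subadditive_finite) (use assms G sets_N \<omega> in \<open>auto simp: occupied_def\<close>)
        moreover have "(\<Union>ys\<in>D. {loop_class ys}) = loop_class ` D" by auto
        ultimately show False using \<omega> by (simp add: occupied_def)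
      qed
      then show "\<omega> \<in> (\<Union>ys\<in>D. occupied {loop_class ys})" using \<omega> by (auto simp: occupied_def)
    qed
    show "(\<Union>ys\<in>D. occupied {loop_class ys}) \<in> events"
      using assms loop_class_in_loops by (intro sets.finite_UN occupied_events) auto
  qed
  finally show ?thesis .
qed

text \<open>Measurability is what allows the probability of the connection to be bounded below by
  that of an arm.\<close>

lemma connected_event:
  "{\<omega> \<in> space M. connected_to (N \<omega>) x A} \<in> events"
proof -
  have edge: "{\<omega> \<in> space M. open_edge (N \<omega>) x y} \<in> events" for x y
  proof -
    have "{\<omega> \<in> space M. open_edge (N \<omega>) x y} = (\<Union>l\<in>{l \<in> loops. zadj x y \<and> traverses l {x, y}}. occupied {l})"
      by (auto simp: open_edge_def occupied_def)
    also have "\<dots> \<in> events"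
      by (rule sets.countable_UN') (auto intro!: occupied_events countable_subset[OF _ countable_loops])
    finally show ?thesis .
  qed
  have walk: "{\<omega> \<in> space M. (open_edge (N \<omega>) ^^ n) x y} \<in> events" for n y
  proof (induction n arbitrary: y)
    case (Suc n)
    have "{\<omega> \<in> space M. (open_edge (N \<omega>) ^^ Suc n) x y} =
        (\<Union>z\<in>UNIV. {\<omega> \<in> space M. (open_edge (N \<omega>) ^^ n) x z} \<inter> {\<omega> \<in> space M. open_edge (N \<omega>) z y})"
      by auto
    also have "\<dots> \<in> events"
      by (rule sets.countable_UN') (use Suc edge in auto)
    finally show ?case .
  qed simp
  have "{\<omega> \<in> space M. connected_to (N \<omega>) x A} = (\<Union>y\<in>A. \<Union>n. {\<omega> \<in> space M. (open_edge (N \<omega>) ^^ n) x y})"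
    by (auto simp: connected_to_def rtranclp_power)
  also have "\<dots> \<in> events"
    by (intro sets.countable_UN' walk) (use walk in auto)
  finally show ?thesis .
qed

end

subsection \<open>Chains of loops\<close>

definition scale_classes :: "nat \<Rightarrow> (int ^ 4) list set set" where
  "scale_classes k = {l \<in> loops. \<exists>ys\<in>l. length ys \<in> scale_lengths k}"

lemma scale_lengths_disjoint: "i < j \<Longrightarrow> scale_lengths i \<inter> scale_lengths j = {}"
proof -
  assume "i < j"
  then have "(4::nat) ^ Suc i \<le> 4 ^ j" by (intro power_increasing) auto
  then show ?thesis by (auto simp: scale_lengths_def)
qed

lemma length_eq_in_loop:
  fixes l :: "(int ^ 4) list set"
  assumes "l \<in> loops" "ys \<in> l" "zs \<in> l"
  shows "length ys = length zs"
proof -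
  obtain ws where "l = loop_class ws" using assms(1) by (auto simp: loops_def quotient_def)
  then show ?thesis using assms(2,3) by (auto simp: circular_perm_def)
qed

lemma scale_classes_disjoint: "i < j \<Longrightarrow> scale_classes i \<inter> scale_classes j = {}"
proof -
  assume ij: "i < j"
  have False if l: "l \<in> scale_classes i" "l \<in> scale_classes j" for l
  proof -
    obtain ys zs where "l \<in> loops" "ys \<in> l" "zs \<in> l" "length ys \<in> scale_lengths i" "length zs \<in> scale_lengths j"
      using l by (auto simp: scale_classes_def)
    then show False using length_eq_in_loop[of l ys zs] scale_lengths_disjoint[OF ij] by auto
  qed
  then show ?thesis by blast
qed

lemma scale_loops_memD:
  assumes ys: "ys \<in> scale_loops k Q xs" and Q: "\<And>n. Q n \<subseteq> closed_steps n"
  obtains s x n where "n \<in> scale_lengths k" "n \<ge> 2" "s \<in> Q n" "s \<in> closed_steps n" "length s = n" "ys = loop_at x s"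
    "set ys \<inter> set xs \<noteq> {}"
proof -
  obtain s x n where h: "n \<in> scale_lengths k" "s \<in> Q n" "x \<in> hits xs s" "ys = loop_at x s"
    using ys by (auto simp: scale_loops_def)
  have c: "s \<in> closed_steps n" using h Q by blast
  then have l: "length s = n" by (simp add: closed_steps_def steps_def)
  obtain i j where ij: "i < length xs" "j < length s" "x = xs ! i - part s j"
    using h by (auto simp: hits_def)
  have "ys ! j = xs ! i" using ij h by simp
  then have "xs ! i \<in> set ys \<inter> set xs"
    using ij h(4) by (metis IntI length_loop_at nth_mem)
  then show thesis using that[OF h(1) scale_lengths_ge_2[OF h(1)] h(2) c l h(4)] by blast
qed

lemma scale_loops_based:
  assumes ys: "ys \<in> scale_loops k Q xs" and Q: "\<And>n. Q n \<subseteq> closed_steps n"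
  shows "ys \<in> based_loops" "loop_class ys \<in> scale_classes k" "ys \<noteq> []"
proof -
  obtain s x n where h: "n \<in> scale_lengths k" "n \<ge> 2" "s \<in> closed_steps n" "length s = n" "ys = loop_at x s"
    by (rule scale_loops_memD[OF assms])
  show b: "ys \<in> based_loops" using based_loop_loop_at(1)[OF h(3,2)] h(5) by simp
  show "loop_class ys \<in> scale_classes k"
    unfolding scale_classes_def
    using loop_class_in_loops[OF b] h by (intro CollectI conjI bexI[OF _ self_in_loop_class[OF b]]) auto
  show "ys \<noteq> []" using h by (auto simp: loop_at_def)
qed

lemma low_energy_steps_closed: "low_energy_steps n \<subseteq> closed_steps n"
  by (auto simp: low_energy_steps_def)

lemma wide_steps_closed: "wide_steps r n \<subseteq> closed_steps n"
  by (auto simp: wide_steps_def)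

text \<open>Since 24576 = 4 * 6144, \<open>threshold (Suc k)\<close> is at most 4^k / (6144 k), the
  reciprocal energy guaranteed for a low-energy loop of scale k. The value at k = 0 is 0 by division
  by zero, so chains start at scale 1.\<close>

definition threshold :: "nat \<Rightarrow> real" where
  "threshold k = 4 ^ k / (24576 * real k)"

text \<open>Doubling guarantees that raising a value below \<open>threshold k\<close> to
  \<open>threshold (Suc k)\<close> gains at least \<open>threshold k\<close>.\<close>

lemma threshold_Suc_ge: "k \<ge> 1 \<Longrightarrow> threshold (Suc k) \<ge> 2 * threshold k"
  by (simp add: threshold_def divide_simps)

lemma energy_scale_loops:
  assumes ys: "ys \<in> scale_loops k low_energy_steps xs" and k: "k \<ge> 1"
  shows "1 / energy ys \<ge> threshold (Suc k)"
proof -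
  obtain s x n where h: "n \<in> scale_lengths k" "n \<ge> 2" "s \<in> low_energy_steps n" "length s = n" "ys = loop_at x s"
    by (rule scale_loops_memD[OF ys low_energy_steps_closed])
  have n: "2 * 4 ^ k \<le> n" "n < 4 * 4 ^ k" using h(1) by (auto simp: scale_lengths_def)
  have n1: "2 * 4 ^ k \<le> real n" using of_nat_mono[OF n(1), where 'a = real] by simp
  have "n + 1 \<le> 4 ^ Suc k" using n by simp
  from of_nat_mono[OF this, where 'a = real] have "real n + 1 \<le> 4 ^ Suc k" by (simp add: add.commute)
  then have "ln (real n + 1) \<le> ln (4 ^ Suc k)" by (intro ln_mono) auto
  also have "\<dots> = real (Suc k) * ln 4" by (rule ln_realpow)
  also have "ln 4 = 2 * ln (2::real)"
    using ln_realpow[of "2::real" 2] by simp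
  also have "real (Suc k) * (2 * ln 2) \<le> real (Suc k) * (3 / 2)"
    using ln2_le_25_over_36 by (intro mult_left_mono) auto
  \<comment> \<open>The bound so far is 1 + 3 (k + 1) / 2, which equals 4k at k = 1.\<close>
  finally have ln: "1 + ln (real n + 1) \<le> 4 * real k" using k by simp
  have "energy ys = energy (loop_at 0 s)" using h by (simp add: energy_loop_at)
  also have "\<dots> \<le> 3072 * (1 + ln (real n + 1)) / real n" using h by (simp add: low_energy_steps_def)
  also have "\<dots> \<le> 3072 * (4 * real k) / (2 * 4 ^ k)"
    using ln n1 k by (intro frac_le mult_left_mono) auto
  also have "\<dots> = 6144 * real k / 4 ^ k" by simp
  finally have e: "energy ys \<le> 6144 * real k / 4 ^ k" .
  have pos: "energy ys > 0" using h by (intro energy_pos) (auto simp: loop_at_def)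
  have "threshold (Suc k) \<le> 4 ^ k / (6144 * real k)"
    using k by (simp add: threshold_def divide_simps)
  also have "\<dots> = 1 / (6144 * real k / 4 ^ k)" by simp
  also have "\<dots> \<le> 1 / energy ys"
    using e pos k by (intro divide_left_mono) auto
  finally show ?thesis .
qed

text \<open>Young's inequality with second factor 1. It compares the gain 1 + eps / k with ((k + 1)
  / k)^eps, and these powers telescope over the scales.\<close>

lemma powr_Bernoulli_le:
  fixes x \<epsilon> :: real
  assumes "x \<ge> 0" "0 \<le> \<epsilon>" "\<epsilon> \<le> 1"
  shows "(1 + x) powr \<epsilon> \<le> 1 + \<epsilon> * x"
  using Youngs_inequality_0[of \<epsilon> "1 - \<epsilon>" "1 + x" 1] assms by (simp add: algebra_simps)

lemma one_minus_exp_ge: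
  fixes u :: real
  assumes "0 \<le> u" "u \<le> a"
  shows "1 - exp (- u) \<ge> u / (1 + a)"
proof -
  have "1 + u \<le> exp u" by (rule exp_ge_add_one_self)
  then have "exp (- u) \<le> 1 / (1 + u)" using assms by (simp add: exp_minus divide_simps)
  moreover have "1 - 1 / (1 + u) = u / (1 + u)" using assms by (simp add: divide_simps)
  moreover have "u / (1 + a) \<le> u / (1 + u)" using assms by (intro divide_left_mono) auto
  ultimately show ?thesis by linarith
qed

text \<open>Arms are shown to leave the ball, whereas the theorem asks for its boundary: the last
  vertex of the path inside \<open>F\<close> is followed by a neighbour outside.\<close>

lemma open_path_exits:
  assumes "(open_edge L)\<^sup>*\<^sup>* x y" "x \<in> F" "y \<notin> F"
  shows "connected_to L x (inner_boundary F)"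
  using assms
proof (induction rule: rtranclp_induct)
  case (step y z)
  show ?case
  proof (cases "y \<in> F")
    case True
    then have "y \<in> inner_boundary F" using step by (auto simp: inner_boundary_def open_edge_def)
    then show ?thesis using step by (auto simp: connected_to_def)
  qed (use step in simp)
qed simp

lemma open_edge_sym: "open_edge L x y \<Longrightarrow> open_edge L y x"
  by (auto simp: open_edge_def zadj_def abs_minus_commute insert_commute)

lemma loop_at_connected:
  assumes s: "s \<in> closed_steps n" "n \<ge> 2" and L: "emeasure L {loop_class (loop_at x s)} \<noteq> 0"
    and y: "y \<in> set (loop_at x s)" and z: "z \<in> set (loop_at x s)"
  shows "(open_edge L)\<^sup>*\<^sup>* y z"
proof -
  let ?ys = "loop_at x s"
  have l: "length s = n" using s by (simp add: closed_steps_def steps_def)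
  have based: "?ys \<in> based_loops" by (rule based_loop_loop_at(1)[OF s])
  have edge: "open_edge L (?ys ! i) (?ys ! (Suc i mod n))" if "i < n" for i
    unfolding open_edge_def traverses_def
    using zadj_loop_at[OF s(1) that] L loop_class_in_loops[OF based] self_in_loop_class[OF based] l that
    by (metis length_loop_at)
  have from0: "(open_edge L)\<^sup>*\<^sup>* (?ys ! 0) (?ys ! i)" if "i < n" for i
    using that
  proof (induction i)
    case (Suc i)
    then show ?case using edge[of i] by (simp add: rtranclp.rtrancl_into_rtrancl)
  qed simp
  have sym: "(open_edge L)\<^sup>*\<^sup>* b a" if "(open_edge L)\<^sup>*\<^sup>* a b" for a b
    using that by (induction rule: rtranclp_induct) (auto intro: converse_rtranclp_into_rtranclp open_edge_sym)
  obtain i j where "i < n" "j < n" "y = ?ys ! i" "z = ?ys ! j"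
    using y z l by (metis in_set_conv_nth length_loop_at)
  then show ?thesis using sym[OF from0[of i]] from0[of j] by auto
qed

section \<open>Arm events and the recursion over scales\<close>

context loop_soup_process
begin

text \<open>\<open>arm r m j xs\<close> says that an open chain of loops, one from some of the scales $m - j, \dots, m$ each in
  increasing order, leads from \<open>xs\<close> to a loop at scale $m$ that is too wide to fit into the ball of radius $r$.\<close>

fun arm :: "nat \<Rightarrow> nat \<Rightarrow> nat \<Rightarrow> (int ^ 4) list \<Rightarrow> 'w set" where
  "arm r m 0 xs = (\<Union>ys\<in>scale_loops m (wide_steps r) xs. occupied {loop_class ys})"
| "arm r m (Suc j) xs = arm r m j xs \<union>
     (\<Union>ys\<in>scale_loops (m - Suc j) low_energy_steps xs. occupied {loop_class ys} \<inter> arm r m j ys)"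

text \<open>This makes an arm of depth \<open>j\<close> independent of the loops of scale m - j - 1,
  which the next step of the recursion puts in front of it.\<close>

lemma arm_past: "j \<le> m \<Longrightarrow> arm r m j xs \<in> past (\<Union>k\<in>{m - j..}. scale_classes k)"
proof (induction j arbitrary: xs)
  case 0
  interpret sigma_algebra "space M" "past (\<Union>k\<in>{m - 0..}. scale_classes k)"
    by (rule sigma_algebra_past) (auto simp: scale_classes_def)
  show ?case unfolding arm.simps
    by (intro finite_UN finite_scale_loops occupied_past wide_steps_closed UN_I[of m] scale_loops_based(2)[OF _ wide_steps_closed]) auto
next
  case (Suc j)
  let ?J = "\<Union>k\<in>{m - Suc j..}. scale_classes k"
  interpret sigma_algebra "space M" "past ?J"
    by (rule sigma_algebra_past) (auto simp: scale_classes_def)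
  have arm: "arm r m j ys \<in> past ?J" for ys
  proof -
    have "(\<Union>k\<in>{m - j..}. scale_classes k) \<subseteq> ?J" by (intro UN_mono) auto
    from past_mono[OF this] show ?thesis using Suc.IH[of ys] Suc.prems by auto
  qed
  show ?case unfolding arm.simps
    by (intro Un finite_UN Int finite_scale_loops occupied_past low_energy_steps_closed arm
        UN_I[of "m - Suc j"] scale_loops_based(2)[OF _ low_energy_steps_closed]) auto
qed

lemma arm_sound:
  assumes "\<omega> \<in> arm r m j xs"
  shows "\<exists>x\<in>set xs. \<exists>y. (open_edge (N \<omega>))\<^sup>*\<^sup>* x y \<and> y \<notin> zball 0 r"
  using assms
proof (induction j arbitrary: xs)
  case 0
  then obtain ys where ys: "ys \<in> scale_loops m (wide_steps r) xs" "emeasure (N \<omega>) {loop_class ys} \<noteq> 0"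
    by (auto simp: occupied_def)
  obtain s x n where h: "n \<ge> 2" "s \<in> wide_steps r n" "s \<in> closed_steps n" "length s = n" "ys = loop_at x s"
    "set ys \<inter> set xs \<noteq> {}"
    by (rule scale_loops_memD[OF ys(1) wide_steps_closed])
  obtain i where i: "i < n" "linf_norm (part s i) > int (2 * r)"
    using h by (auto simp: wide_steps_def)
  have "\<exists>y\<in>set ys. y \<notin> zball 0 r"
  proof (rule ccontr)
    assume "\<not> (\<exists>y\<in>set ys. y \<notin> zball 0 r)"
    then have in_ball: "ys ! k \<in> zball 0 r" if "k < n" for k
      using that h by (metis length_loop_at nth_mem)
    \<comment> \<open>Entries 0 and \<open>i\<close> of the loop: \<open>part s 0\<close> vanishes,
      so they differ by the long displacement \<open>part s i\<close>.\<close>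
    have "x \<in> zball 0 r" "x + part s i \<in> zball 0 r"
      using in_ball[of 0] in_ball[OF i(1)] h i by (auto simp: part_def)
    then have b: "\<bar>x $ a\<bar> \<le> int r" "\<bar>x $ a + part s i $ a\<bar> \<le> int r" for a
      by (auto simp: zball_def linf_norm_le_iff)
    have "\<bar>part s i $ a\<bar> \<le> int (2 * r)" for a
      using b[of a] by (auto simp: abs_le_iff)
    then show False using i(2) linf_norm_le_iff[of "part s i" "int (2 * r)"] by auto
  qed
  then obtain y where y: "y \<in> set ys" "y \<notin> zball 0 r" by blast
  obtain w where w: "w \<in> set ys" "w \<in> set xs" using h by blast
  have "(open_edge (N \<omega>))\<^sup>*\<^sup>* w y"
    using loop_at_connected[OF h(3,1)] ys(2) w y h(5) by blast
  then show ?case using w y by blast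
next
  case (Suc j)
  then consider "\<omega> \<in> arm r m j xs" | ys where "ys \<in> scale_loops (m - Suc j) low_energy_steps xs"
    "emeasure (N \<omega>) {loop_class ys} \<noteq> 0" "\<omega> \<in> arm r m j ys"
    by (auto simp: occupied_def)
  then show ?case
  proof cases
    case 1
    then show ?thesis by (rule Suc.IH)
  next
    case (2 ys)
    obtain s x n where h: "n \<ge> 2" "s \<in> closed_steps n" "ys = loop_at x s" "set ys \<inter> set xs \<noteq> {}"
      by (rule scale_loops_memD[OF 2(1) low_energy_steps_closed])
    obtain z y where zy: "z \<in> set ys" "(open_edge (N \<omega>))\<^sup>*\<^sup>* z y" "y \<notin> zball 0 r"
      using Suc.IH[OF 2(3)] by blast
    obtain w where w: "w \<in> set ys" "w \<in> set xs" using h by blast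
    have "(open_edge (N \<omega>))\<^sup>*\<^sup>* w z"
      using loop_at_connected[OF h(2,1)] 2(2) w zy(1) h(3) by blast
    then show ?thesis using w zy by (meson rtranclp_trans)
  qed
qed

text \<open>The constant 147456 is that of \<open>weight_scale_loops_ge\<close>; the factor 1 +
  \<open>\<alpha>\<close> comes from replacing 1 - exp (-u) by a linear function for u up to
  \<open>\<alpha>\<close>.\<close>

definition rate :: real where
  "rate = \<alpha> / (147456 * (1 + \<alpha>))"

text \<open>The cap at \<open>threshold k\<close>, which is below 4^k, keeps the mass
  \<open>u\<close> at most \<open>\<alpha>\<close>, in the range where the occupation probability is
  comparable to the mass.\<close>

lemma prob_scale_loops_occupied_ge:
  assumes k: "k \<ge> 1" and xs: "xs \<noteq> []" and Q: "\<And>n. Q n \<subseteq> closed_steps n"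
    and card_Q: "\<And>n. n \<in> scale_lengths k \<Longrightarrow> real (card (Q n)) \<ge> 8 ^ n * (1 / (12 * (real n)\<^sup>2))"
  shows "prob (\<Union>ys\<in>scale_loops k Q xs. occupied {loop_class ys}) \<ge> rate * min (1 / energy xs) (threshold k) / 4 ^ k"
proof -
  let ?Y = "min (1 / energy xs) (threshold k)"
  let ?W = "\<Sum>ys\<in>scale_loops k Q xs. based_loop_weight ys"
  define u where "u = \<alpha> * ?Y / (147456 * 4 ^ k)"
  have E: "energy xs > 0" by (rule energy_pos[OF xs])
  have T: "threshold k > 0" "threshold k \<le> 4 ^ k"
    using k by (auto simp: threshold_def divide_simps)
  have Y: "0 \<le> ?Y" "?Y \<le> 4 ^ k" using E T by auto
  have u: "0 \<le> u" "u \<le> \<alpha>"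
  proof -
    show "0 \<le> u" unfolding u_def using \<alpha>_pos Y by simp
    have "u \<le> \<alpha> * 4 ^ k / (147456 * 4 ^ k)"
      unfolding u_def using \<alpha>_pos Y by (intro divide_right_mono mult_left_mono) auto
    also have "\<dots> \<le> \<alpha>" using \<alpha>_pos by simp
    finally show "u \<le> \<alpha>" .
  qed
  have "u \<le> \<alpha> * (1 / energy xs) / (147456 * 4 ^ k)"
    unfolding u_def using \<alpha>_pos by (intro divide_right_mono mult_left_mono) auto
  also have "\<dots> = \<alpha> * (1 / (147456 * 4 ^ k * energy xs))" by simp
  also have "\<dots> \<le> \<alpha> * ?W"
    using weight_scale_loops_ge[OF xs Q card_Q] \<alpha>_pos by (intro mult_left_mono) auto
  finally have uW: "u \<le> \<alpha> * ?W" .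
  have "rate * ?Y / 4 ^ k = u / (1 + \<alpha>)" by (simp add: rate_def u_def)
  also have "\<dots> \<le> 1 - exp (- u)" by (rule one_minus_exp_ge[OF u])
  also have "\<dots> \<le> 1 - exp (- (\<alpha> * ?W))" using uW by simp
  also have "\<dots> \<le> prob (\<Union>ys\<in>scale_loops k Q xs. occupied {loop_class ys})"
    by (rule prob_some_loop_occupied_ge) (use finite_scale_loops[OF Q] scale_loops_based(1)[OF _ Q] in auto)
  finally show ?thesis .
qed

text \<open>Chosen so that rate * threshold k / 4^k = exponent / k, the relative gain at scale
  k.\<close>

definition exponent :: real where
  "exponent = rate / 24576"

lemma rate_pos: "rate > 0"
  using \<alpha>_pos by (simp add: rate_def)

lemma exponent_bounds: "0 < exponent" "exponent \<le> 1"
  using \<alpha>_pos by (auto simp: exponent_def rate_def divide_simps)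

text \<open>Going from scale $k$ to scale $k + 1$ improves the bound by the factor $1 + \varepsilon / k$: with probability of
  order $Y / 4^k$ a loop at scale $k$ is met, and then $Y$ is replaced by the threshold at scale $k + 1$.\<close>

lemma prob_arm_ge:
  assumes r: "m \<ge> 1" "28 * (4 * r + 1)\<^sup>2 \<le> 4 ^ m" and "j < m" "xs \<noteq> []"
  shows "prob (arm r m j xs) \<ge>
    rate / 4 ^ m * (real m / real (m - j)) powr exponent * min (1 / energy xs) (threshold (m - j))"
  using assms(3,4)
proof (induction j arbitrary: xs)
  case 0
  have "prob (\<Union>ys\<in>scale_loops m (wide_steps r) xs. occupied {loop_class ys}) \<ge> rate * min (1 / energy xs) (threshold m) / 4 ^ m"
  proof (rule prob_scale_loops_occupied_ge[OF r(1) 0(2) wide_steps_closed])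
    fix n assume n: "n \<in> scale_lengths m"
    then show "real (card (wide_steps r n)) \<ge> 8 ^ n * (1 / (12 * (real n)\<^sup>2))"
      using r(2) scale_lengths_ge_2[OF n] by (intro card_wide_steps) (auto simp: scale_lengths_def)
  qed
  then show ?case using r(1) by simp
next
  case (Suc j)
  define k where "k = m - Suc j"
  have k: "k \<ge> 1" "m - j = Suc k" using Suc.prems by (auto simp: k_def)
  define a where "a = rate / 4 ^ m * (real m / real (Suc k)) powr exponent"
  have a: "a \<ge> 0" unfolding a_def using rate_pos by simp
  let ?Y = "min (1 / energy xs) (threshold k)"
  let ?B = "\<Union>ys\<in>scale_loops k low_energy_steps xs. occupied {loop_class ys}"
  have E: "energy xs > 0" by (rule energy_pos[OF Suc.prems(2)])
  have T: "threshold k > 0" "threshold (Suc k) \<ge> 2 * threshold k"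
    using k threshold_Suc_ge by (auto simp: threshold_def)
  have Y: "?Y \<ge> 0" using E T by simp
  have IH: "prob (arm r m j ys) \<ge> a * min (1 / energy ys) (threshold (Suc k))" if "ys \<noteq> []" for ys
    using Suc.IH[of ys] Suc.prems that k by (simp add: a_def)
  have pB: "prob ?B \<ge> rate * ?Y / 4 ^ k"
  proof (rule prob_scale_loops_occupied_ge[OF k(1) Suc.prems(2) low_energy_steps_closed])
    fix n assume n: "n \<in> scale_lengths k"
    then show "real (card (low_energy_steps n)) \<ge> 8 ^ n * (1 / (12 * (real n)\<^sup>2))"
      using scale_lengths_ge_2[OF n] by (intro card_low_energy_steps) (auto simp: scale_lengths_def)
  qed
  have arm_j: "arm r m j zs \<in> past (\<Union>i\<in>{Suc k..}. scale_classes i)" for zs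
    using arm_past[of j m r zs] Suc.prems k by simp
  \<comment> \<open>The fallback skips scale k and keeps the value \<open>?Y\<close>; after meeting
    a low-energy loop the arm continues from it with the full value
    \<open>threshold (Suc k)\<close>.\<close>
  have "prob (space M \<inter> (arm r m j xs \<union> (\<Union>ys\<in>scale_loops k low_energy_steps xs. occupied {loop_class ys} \<inter> arm r m j ys)))
     \<ge> (a * ?Y) * prob (space M) + (a * threshold (Suc k) - a * ?Y) * prob (space M \<inter> ?B)"
  proof (rule prob_union_cond_ge)
    show "sigma_algebra (space M) (past (scale_classes k))" "past (scale_classes k) \<subseteq> events"
      by (rule sigma_algebra_past past_events, force simp: scale_classes_def)+
    show "past (\<Union>i\<in>{Suc k..}. scale_classes i) \<subseteq> events"
      by (rule past_events) (auto simp: scale_classes_def)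
    show "prob (X \<inter> Y) = prob X * prob Y"
      if "X \<in> past (scale_classes k)" "Y \<in> past (\<Union>i\<in>{Suc k..}. scale_classes i)" for X Y
    proof (rule indep_past[OF _ _ _ that])
      show "scale_classes k \<inter> (\<Union>i\<in>{Suc k..}. scale_classes i) = {}"
        using scale_classes_disjoint[of k] by (auto simp: Suc_le_eq disjoint_iff)
    qed (auto simp: scale_classes_def)
    show "finite (scale_loops k low_energy_steps xs)"
      by (rule finite_scale_loops[OF low_energy_steps_closed])
    show "arm r m j xs \<in> past (\<Union>i\<in>{Suc k..}. scale_classes i)" by (rule arm_j)
    show "space M \<in> past (scale_classes k)"
      unfolding past_def by (rule sigma_sets_top)
    show "a * ?Y \<le> prob (arm r m j xs)"
    proof -
      have "a * ?Y \<le> a * min (1 / energy xs) (threshold (Suc k))"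
        using T by (intro mult_left_mono a) auto
      then show ?thesis using IH[OF Suc.prems(2)] by linarith
    qed
    fix ys assume ys: "ys \<in> scale_loops k low_energy_steps xs"
    show "arm r m j ys \<in> past (\<Union>i\<in>{Suc k..}. scale_classes i)" by (rule arm_j)
    show "occupied {loop_class ys} \<in> past (scale_classes k)"
      by (intro occupied_past scale_loops_based(2)[OF ys low_energy_steps_closed])
    show "a * threshold (Suc k) \<le> prob (arm r m j ys)"
      using IH[OF scale_loops_based(3)[OF ys low_energy_steps_closed]] energy_scale_loops[OF ys k(1)]
      by (simp add: min_absorb2)
  qed
  moreover have "?B \<in> events"
    by (intro sets.finite_UN finite_scale_loops low_energy_steps_closed occupied_events)
      (use scale_loops_based(1)[OF _ low_energy_steps_closed] loop_class_in_loops in auto)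
  moreover have "arm r m (Suc j) xs \<in> events"
    using arm_past[of "Suc j" m r xs] past_events[of "\<Union>i\<in>{m - Suc j..}. scale_classes i"] Suc.prems
    by (auto simp: scale_classes_def)
  ultimately have main: "prob (arm r m (Suc j) xs) \<ge> a * ?Y + (a * threshold (Suc k) - a * ?Y) * prob ?B"
    by (simp add: k_def prob_space sets.Int_space_eq1)
  have "a * ?Y * (1 + exponent / real k) = a * ?Y + a * threshold k * (rate * ?Y / 4 ^ k)"
    using k(1) by (simp add: exponent_def threshold_def field_simps)
  also have "\<dots> \<le> a * ?Y + (a * threshold (Suc k) - a * ?Y) * prob ?B"
  proof -
    have "a * threshold k \<le> a * (threshold (Suc k) - ?Y)"
      using T by (intro mult_left_mono a) auto
    moreover have "a * ?Y \<le> a * threshold (Suc k)"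
      using T by (intro mult_left_mono a) auto
    ultimately have "a * threshold k * (rate * ?Y / 4 ^ k) \<le> (a * threshold (Suc k) - a * ?Y) * prob ?B"
      using pB a T Y rate_pos by (intro mult_mono) (auto simp: right_diff_distrib)
    then show ?thesis by simp
  qed
  finally have grow: "a * ?Y * (1 + exponent / real k) \<le> prob (arm r m (Suc j) xs)" using main by linarith
  have "(real m / real k) powr exponent = (real m / real (Suc k)) powr exponent * (1 + 1 / real k) powr exponent"
  proof -
    have "1 + 1 / real k = real (Suc k) / real k"
      using k(1) by (simp add: field_simps)
    then have "real m / real k = real m / real (Suc k) * (1 + 1 / real k)"
      by (simp del: of_nat_Suc)
    then show ?thesis by (simp only: powr_mult)
  qed
  also have "\<dots> \<le> (real m / real (Suc k)) powr exponent * (1 + exponent * (1 / real k))"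
    using exponent_bounds by (intro mult_left_mono powr_Bernoulli_le) auto
  finally have "rate / 4 ^ m * (real m / real k) powr exponent * ?Y
      \<le> rate / 4 ^ m * ((real m / real (Suc k)) powr exponent * (1 + exponent * (1 / real k))) * ?Y"
    using rate_pos Y by (intro mult_right_mono mult_left_mono) auto
  also have "\<dots> = a * ?Y * (1 + exponent / real k)" by (simp add: a_def)
  finally show ?case using grow by (simp add: k_def)
qed

section \<open>Choice of the top scale\<close>

lemma energy_singleton_le: "energy [x] \<le> 4"
  using green_le[of 0] by (simp add: energy_def)

lemma one_arm_ge:
  assumes "n \<ge> 1"
  shows "prob {\<omega> \<in> space M. connected_to (N \<omega>) 0 (inner_boundary (zball 0 n))} \<ge>
    rate / 17203200 * real n powr (-2) * ln (real n) powr exponent"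
proof -
  \<comment> \<open>Here 700 = 28 * 5^2, because 4n + 1 is at most 5n. Minimality gives the converse
    bound 4^m <= 2800 n^2, so no power of n is lost.\<close>
  define m where "m = (LEAST m. 700 * n\<^sup>2 \<le> 4 ^ m)"
  have ex: "700 * n\<^sup>2 \<le> 4 ^ (700 * n\<^sup>2)"
    using less_exp[of "700 * n\<^sup>2"] power_mono[of 2 "4::nat" "700 * n\<^sup>2"] by linarith
  have m: "700 * n\<^sup>2 \<le> 4 ^ m" unfolding m_def by (rule LeastI[of "\<lambda>m. 700 * n\<^sup>2 \<le> 4 ^ m", OF ex])
  have n2: "n\<^sup>2 \<ge> 1" using assms by simp
  have m1: "m \<ge> 1" using m n2 by (cases m) auto
  have "\<not> 700 * n\<^sup>2 \<le> 4 ^ (m - 1)"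
    unfolding m_def by (rule not_less_Least) (use m1 in \<open>simp add: m_def\<close>)
  then have up: "4 ^ m \<le> 2800 * n\<^sup>2" using m1 by (cases m) auto
  have upr: "(4::real) ^ m \<le> 2800 * (real n)\<^sup>2" using of_nat_mono[OF up, where 'a = real] by simp
  have ln_m: "ln (real n) \<le> real m"
  proof -
    have "(4::nat) ^ m = (2 ^ m)\<^sup>2" by (simp add: power2_eq_square flip: power_mult_distrib)
    then have "n\<^sup>2 \<le> (2 ^ m)\<^sup>2" using m by linarith
    then have "n \<le> 2 ^ m" by (rule power2_le_imp_le) simp
    from of_nat_mono[OF this, where 'a = real] have "real n \<le> 2 ^ m" by simp
    then have "ln (real n) \<le> ln (2 ^ m)" using assms by (intro ln_mono) auto
    also have "\<dots> = real m * ln 2" by (rule ln_realpow)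
    also have "\<dots> \<le> real m * 1" using ln2_le_25_over_36 by (intro mult_left_mono) auto
    finally show ?thesis by simp
  qed
  have wide: "28 * (4 * n + 1)\<^sup>2 \<le> 4 ^ m"
  proof -
    have "(4 * n + 1)\<^sup>2 \<le> (5 * n)\<^sup>2" using assms by (intro power_mono) auto
    then show ?thesis using m by (simp add: power_mult_distrib)
  qed
  \<comment> \<open>The chain starts from the single vertex 0. Its reciprocal energy is at least 1 /
    4, and \<open>threshold 1\<close> is 4 / 24576 = 1 / 6144.\<close>
  have Y: "min (1 / energy [0]) (threshold 1) \<ge> 1 / 6144"
  proof -
    have "1 / 4 \<le> 1 / energy [0]"
      using energy_singleton_le[of 0] energy_pos[of "[0]"] by (intro divide_left_mono) auto
    then show ?thesis by (simp add: threshold_def)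
  qed
  \<comment> \<open>The constant is 17203200 = 2800 * 6144.\<close>
  have "rate / 17203200 * real n powr (-2) * ln (real n) powr exponent
     = rate / (2800 * (real n)\<^sup>2) * ln (real n) powr exponent * (1 / 6144)"
    using assms by (simp add: powr_minus_divide)
  also have "\<dots> \<le> rate / 4 ^ m * real m powr exponent * min (1 / energy [0]) (threshold 1)"
    using upr ln_m Y rate_pos assms exponent_bounds
    by (intro mult_mono divide_left_mono powr_mono2) auto
  \<comment> \<open>Depth m - 1 uses all scales from 1 to m, so the accumulated gain is the full
    power of m, which dominates that of ln n.\<close>
  also have "\<dots> = rate / 4 ^ m * (real m / real (m - (m - 1))) powr exponent * min (1 / energy [0]) (threshold (m - (m - 1)))"
    using m1 by simp
  also have "\<dots> \<le> prob (arm n m (m - 1) [0])"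
    by (rule prob_arm_ge[OF m1 wide]) (use m1 in auto)
  also have "\<dots> \<le> prob {\<omega> \<in> space M. connected_to (N \<omega>) 0 (inner_boundary (zball 0 n))}"
  proof (rule finite_measure_mono[OF _ connected_event])
    have sub: "arm n m (m - 1) [0] \<subseteq> space M"
      using arm_past[of "m - 1" m n "[0]"] past_events[of "\<Union>i\<in>{m - (m - 1)..}. scale_classes i"] sets.sets_into_space
      by (auto simp: scale_classes_def)
    show "arm n m (m - 1) [0] \<subseteq> {\<omega> \<in> space M. connected_to (N \<omega>) 0 (inner_boundary (zball 0 n))}"
    proof
      fix \<omega> assume \<omega>: "\<omega> \<in> arm n m (m - 1) [0]"
      obtain y where y: "(open_edge (N \<omega>))\<^sup>*\<^sup>* 0 y" "y \<notin> zball 0 n"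
        using arm_sound[OF \<omega>] by auto
      have "(0 :: int ^ 4) \<in> zball 0 n" by (simp add: zball_def linf_norm_le_iff)
      from open_path_exits[OF y(1) this y(2)]
      show "\<omega> \<in> {\<omega> \<in> space M. connected_to (N \<omega>) 0 (inner_boundary (zball 0 n))}"
        using sub \<omega> by auto
    qed
  qed
  finally show ?thesis .
qed

end

theorem theorem1p6:
  fixes \<alpha> :: real
  assumes "\<alpha> > 0"
  shows "\<exists>\<epsilon>>0. \<exists>c>0. \<forall>(M :: 'w measure) (N :: 'w \<Rightarrow> (int ^ 4) list set measure).
           loop_soup \<alpha> M N \<longrightarrow>
           (\<forall>n::nat. n \<ge> 1 \<longrightarrow>
              measure M {\<omega> \<in> space M. connected_to (N \<omega>) 0 (inner_boundary (zball 0 n))}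
                \<ge> c * real n powr (-2) * ln (real n) powr \<epsilon>)"
proof -
  \<comment> \<open>This is \<open>rate\<close>, written out because the witnesses must be fixed
    before the process that instantiates the locale.\<close>
  define \<rho> where "\<rho> = \<alpha> / (147456 * (1 + \<alpha>))"
  have \<rho>: "\<rho> > 0" using assms by (simp add: \<rho>_def)
  show ?thesis
  proof (rule exI[of _ "\<rho> / 24576"], intro exI[of _ "\<rho> / 17203200"] conjI allI impI)
    fix M :: "'w measure" and N :: "'w \<Rightarrow> (int ^ 4) list set measure" and n :: nat
    assume "loop_soup \<alpha> M N" "n \<ge> 1"
    then interpret loop_soup_process \<alpha> M N using assms by unfold_locales
    show "\<rho> / 17203200 * real n powr (-2) * ln (real n) powr (\<rho> / 24576)
        \<le> measure M {\<omega> \<in> space M. connected_to (N \<omega>) 0 (inner_boundary (zball 0 n))}"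
      using one_arm_ge[OF \<open>n \<ge> 1\<close>] by (simp only: \<rho>_def exponent_def rate_def)
  qed (use \<rho> in auto)
qed

end
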